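(* Let $A$ be a system described by a totally disconnected, countable groupoid $\mathbf{G}_A\rightrightarrows\Omega_A$, let $B$ be a system described by a countable, connected groupoid $\mathbf{G}_B\rightrightarrows\Omega_B$, and let $A\times B$ be the composite system described by the direct product groupoid $\mathbf{G}_A\times\mathbf{G}_B\rightrightarrows\Omega_A\times\Omega_B$, with von Neumann algebra $\mathcal{V}(\mathbf{G}_A\times\mathbf{G}_B)$ and fundamental representation $\pi_0\colon\mathcal{V}(\mathbf{G}_A\times\mathbf{G}_B)\to\mathcal{B}(\mathcal{H}_{A\times B})$. Let $(\Phi_t)_{t\in\mathbb{R}}$ be a dynamical evolution of the form $\Phi_t(a)=u_t\,a\,u_t^{\dagger}$ for all $a\in\mathcal{V}(\mathbf{G}_A\times\mathbf{G}_B)$, where $(u_t)_{t\in\mathbb{R}}$, $u_t=\exp(itH)$, is a (strongly continuous) one-parameter group of unitary elements of $\mathcal{V}(\mathbf{G}_A\times\mathbf{G}_B)$. Assume that at the initial time the system is in the separable state $$\varrho=\sum_{x_A\in\Omega_A}p_{x_A}\,\rho_{x_A},\qquad p_{x_A}\ge 0,\quad \sum_{x_A\in\Omega_A}p_{x_A}=1,$$ where for each $x_A\in\Omega_A$ $$\rho_{x_A}(a)=\langle\Psi_{x_A}|\pi_0(a)|\Psi_{x_A}\rangle,\qquad |\Psi_{x_A}\rangle=|x_A\rangle\otimes|\psi_B\rangle ,$$ with $|\psi_B\rangle\in L^2(\Omega_B)$ a unit vector (possibly depending on $x_A$). Then, for every time $t$ elapsed since the initial time, the evolved state $\varrho_t$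 on $\mathcal{V}(\mathbf{G}_A\times\mathbf{G}_B)$, given by $\varrho_t(a)=\varrho(\Phi_t(a))=\varrho(u_t\,a\,u_t^{\dagger})$, is a separable state.
   Context: A groupoid $\mathbf{G}\rightrightarrows\Omega$ has set of objects ("outcomes") $\Omega$, elements ("transitions") $\alpha\colon x\to y$ with source $s(\alpha)=x$ and target $t(\alpha)=y$, composition $\alpha\circ\beta$ defined when $s(\alpha)=t(\beta)$, units $1_x$ and inverses $\alpha^{-1}$. Groupoids are discrete; countable means $\mathbf{G}$ is a countable set. $\mathbf{G}$ is totally disconnected if there is no transition $x\to y$ with $x\ne y$ (isotropy groups may be non-Abelian), and connected if for any $x,y\in\Omega$ there is a transition $x\to y$. The direct product $\mathbf{G}_A\times\mathbf{G}_B\rightrightarrows\Omega_A\times\Omega_B$ has componentwise source, target, composition and inverse. The algebra of transitions $\mathbb{C}[\mathbf{G}]$ is the space of finite formal combinations $\sum_\alpha A_\alpha\,\alpha$ with product $AB=\sum_{s(\alpha)=t(\beta)}A_\alpha B_\beta\,\alpha\circ\beta$ and involution $A^*=\sum_\alpha\overline{A_\alpha}\,\alpha^{-1}$. Let $\mathcal{L}^2(\mathbf{G})$ be the Hilbert space of square summable functions on $\mathbf{G}$. The left-regular representation is $(\lambda(A)\Psi)(\beta)=\sum_{t(\alpha)=t(\beta)}A_\alpha\Psi(\alpha^{-1}\circ\beta)$ and $\mathcal{V}(\mathbf{G}):=(\lambda(\mathbb{C}[\mathbf{G}]))''\subset\mathcal{B}(\mathcal{L}^2(\mathbf{G}))$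 (double commutant). $\mathbb{C}[\mathbf{G}]$ is identified with its image under the faithful map $\lambda$. One has $\mathcal{L}^2(\mathbf{G}_A\times\mathbf{G}_B)\cong\mathcal{L}^2(\mathbf{G}_A)\otimes\mathcal{L}^2(\mathbf{G}_B)$ and, accordingly, $\mathcal{V}(\mathbf{G}_A\times\mathbf{G}_B)=\mathcal{V}(\mathbf{G}_A)\widehat{\otimes}\mathcal{V}(\mathbf{G}_B)$ (von Neumann algebra tensor product), a transition $(\alpha_A,\alpha_B)$ corresponding to $\alpha_A\otimes\alpha_B$. Fundamental representation: $\mathcal{H}_{A\times B}=L^2(\Omega_A\times\Omega_B)\cong L^2(\Omega_A)\otimes L^2(\Omega_B)$ (counting measures), with orthonormal basis $|x_A,x_B\rangle=|x_A\rangle\otimes|x_B\rangle$ of delta functions. $\pi_0$ is the $*$-representation of $\mathcal{V}(\mathbf{G}_A\times\mathbf{G}_B)$ on $\mathcal{H}_{A\times B}$ given on a transition $\alpha\colon(y_A,y_B)\to(z_A,z_B)$ by $\pi_0(\alpha)|x_A,x_B\rangle=\delta_{x_Ay_A}\delta_{x_By_B}|z_A,z_B\rangle$, and on elements $a=\sum_j a^j\alpha_j$ of $\mathcal{V}(\mathbf{G}_A\times\mathbf{G}_B)$ (the sum possibly infinite, converging in the weak topology) by $\pi_0(a)|x_A,x_B\rangle=\sum_j a^j\pi_0(\alpha_j)|x_A,x_B\rangle$. It is a standing assumption that such a $*$-representation $\pi_0$ of $\mathcal{V}(\mathbf{G}_A\times\mathbf{G}_B)$ is given. A state is a normalized positive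 linear functional on the algebra. A state $\rho$ on $\mathcal{V}(\mathbf{G}_A\times\mathbf{G}_B)$ is a product state if there are states $\rho_A$ on $\mathcal{V}(\mathbf{G}_A)$ and $\rho_B$ on $\mathcal{V}(\mathbf{G}_B)$ with $\rho(a\otimes b)=\rho_A(a)\rho_B(b)$ for all $a\in\mathcal{V}(\mathbf{G}_A)$, $b\in\mathcal{V}(\mathbf{G}_B)$. A state is separable if it is a (finite or countably infinite) convex combination of product states; it is entangled otherwise. *)

theory Defs
  imports "HOL-Analysis.Analysis"
begin

typedef 'a ell2 = "{f :: 'a \<Rightarrow> complex. (\<lambda>x. (cmod (f x))\<^sup>2) summable_on UNIV}"
  morphisms ell2_fun Abs_ell2
  by (rule exI[of _ "\<lambda>_. 0"]) simp

setup_lifting type_definition_ell2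

lemma ell2_prod_abs_summable:
  fixes f g :: "'a \<Rightarrow> complex"
  assumes "(\<lambda>x. (cmod (f x))\<^sup>2) summable_on A" "(\<lambda>x. (cmod (g x))\<^sup>2) summable_on A"
  shows "(\<lambda>x. norm (f x * g x)) summable_on A"
proof (rule Infinite_Sum.abs_summable_on_comparison_test')
  show "(\<lambda>x. (cmod (f x))\<^sup>2 + (cmod (g x))\<^sup>2) summable_on A"
    using assms by (rule summable_on_add)
  fix x
  have "0 \<le> (cmod (f x) - cmod (g x))\<^sup>2" "0 \<le> cmod (f x) * cmod (g x)" by auto
  then show "norm (f x * g x) \<le> (cmod (f x))\<^sup>2 + (cmod (g x))\<^sup>2"
    unfolding norm_mult power2_diff mult.assoc by linarith
qed

lemma ell2_add_summable:
  fixes f g :: "'a \<Rightarrow> complex"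
  assumes "(\<lambda>x. (cmod (f x))\<^sup>2) summable_on A" "(\<lambda>x. (cmod (g x))\<^sup>2) summable_on A"
  shows "(\<lambda>x. (cmod (f x + g x))\<^sup>2) summable_on A"
proof (rule summable_on_comparison_test)
  show "(\<lambda>x. 2 * ((cmod (f x))\<^sup>2 + (cmod (g x))\<^sup>2)) summable_on A"
    using assms by (intro summable_on_cmult_right summable_on_add)
  fix x
  have "(cmod (f x + g x))\<^sup>2 \<le> (cmod (f x) + cmod (g x))\<^sup>2"
    by (intro power_mono norm_triangle_ineq) auto
  also have "\<dots> \<le> 2 * ((cmod (f x))\<^sup>2 + (cmod (g x))\<^sup>2)"
    using zero_le_power2[of "cmod (f x) - cmod (g x)"]
    by (simp add: power2_sum power2_diff)
  finally show "(cmod (f x + g x))\<^sup>2 \<le> 2 * ((cmod (f x))\<^sup>2 + (cmod (g x))\<^sup>2)" .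
qed simp

lemma ell2_cmult_summable:
  fixes f :: "'a \<Rightarrow> complex"
  assumes "(\<lambda>x. (cmod (f x))\<^sup>2) summable_on A"
  shows "(\<lambda>x. (cmod (c * f x))\<^sup>2) summable_on A"
  using summable_on_cmult_right[OF assms, of "(cmod c)\<^sup>2"] by (simp add: norm_mult power_mult_distrib)

lift_definition scaleC :: "complex \<Rightarrow> 'a ell2 \<Rightarrow> 'a ell2"  (infixr \<open>*\<^sub>C\<close> 75)
  is "\<lambda>c f x. c * f x" by (rule ell2_cmult_summable)

instantiation ell2 :: (type) real_inner
begin

lift_definition zero_ell2 :: "'a ell2" is "\<lambda>_. 0" by simp
lift_definition plus_ell2 :: "'a ell2 \<Rightarrow> 'a ell2 \<Rightarrow> 'a ell2" is "\<lambda>f g x. f x + g x"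
  by (rule ell2_add_summable)
lift_definition uminus_ell2 :: "'a ell2 \<Rightarrow> 'a ell2" is "\<lambda>f x. - f x" by simp
lift_definition minus_ell2 :: "'a ell2 \<Rightarrow> 'a ell2 \<Rightarrow> 'a ell2" is "\<lambda>f g x. f x - g x"
  using ell2_add_summable[of _ _ "\<lambda>x. - _ x"] by simp
lift_definition scaleR_ell2 :: "real \<Rightarrow> 'a ell2 \<Rightarrow> 'a ell2" is "\<lambda>r f x. complex_of_real r * f x"
  by (rule ell2_cmult_summable)
lift_definition inner_ell2 :: "'a ell2 \<Rightarrow> 'a ell2 \<Rightarrow> real"
  is "\<lambda>f g. Re (\<Sum>\<^sub>\<infinity>x. cnj (f x) * g x)" .
definition "norm (f :: 'a ell2) = sqrt (inner f f)"
definition "dist (f :: 'a ell2) g = norm (f - g)"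
definition "sgn (f :: 'a ell2) = scaleR (inverse (norm f)) f"
definition
  "(uniformity :: ('a ell2 \<times> 'a ell2) filter) = (INF e\<in>{0<..}. principal {(f, g). dist f g < e})"
definition
  "open (U :: 'a ell2 set) = (\<forall>f\<in>U. \<forall>\<^sub>F (f', g) in uniformity. f' = f \<longrightarrow> g \<in> U)"

lemma ell2_cinner_summable:
  fixes f g :: "'a \<Rightarrow> complex"
  assumes "(\<lambda>x. (cmod (f x))\<^sup>2) summable_on A" "(\<lambda>x. (cmod (g x))\<^sup>2) summable_on A"
  shows "(\<lambda>x. cnj (f x) * g x) summable_on A"
  using ell2_prod_abs_summable[of "\<lambda>x. cnj (f x)" A g] assms
  by (simp add: abs_summable_summable)

instance
proof
  fix f g h :: "'a ell2" and r s :: real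
  show "inner f g = inner g f"
  proof transfer
    fix f g :: "'a \<Rightarrow> complex"
    have "(\<Sum>\<^sub>\<infinity>x. cnj (g x) * f x) = cnj (\<Sum>\<^sub>\<infinity>x. cnj (f x) * g x)"
      by (simp flip: infsum_cnj add: mult.commute)
    then show "Re (\<Sum>\<^sub>\<infinity>x. cnj (f x) * g x) = Re (\<Sum>\<^sub>\<infinity>x. cnj (g x) * f x)" by simp
  qed
  show "inner (f + g) h = inner f h + inner g h"
    by transfer (simp add: distrib_right infsum_add ell2_cinner_summable)
  show "inner (r *\<^sub>R f) g = r * inner f g"
    by transfer (simp add: mult.assoc infsum_cmult_right ell2_cinner_summable)
  have *: "inner f f = (\<Sum>\<^sub>\<infinity>x. (cmod (ell2_fun f x))\<^sup>2)"
    for f :: "'a ell2"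
  proof -
    have "(\<Sum>\<^sub>\<infinity>x. cnj (ell2_fun f x) * ell2_fun f x) = (\<Sum>\<^sub>\<infinity>x. complex_of_real ((cmod (ell2_fun f x))\<^sup>2))"
      by (intro infsum_cong) (metis complex_norm_square mult.commute)
    also have "\<dots> = complex_of_real (\<Sum>\<^sub>\<infinity>x. (cmod (ell2_fun f x))\<^sup>2)"
      using ell2_fun[of f] by (intro infsumI has_sum_of_real has_sum_infsum) simp
    finally show ?thesis by (simp add: inner_ell2.rep_eq)
  qed
  show "0 \<le> inner f f" unfolding * by (rule infsum_nonneg) simp
  show "(inner f f = 0) = (f = 0)"
  proof
    assume "inner f f = 0"
    then have "(cmod (ell2_fun f x))\<^sup>2 = 0" for x
      using ell2_fun[of f] unfolding * by (intro nonneg_infsum_le_0D[of _ UNIV]) auto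
    then show "f = 0" by (intro ell2_fun_inject[THEN iffD1]) (auto simp: zero_ell2.rep_eq)
  qed (simp add: * zero_ell2.rep_eq)
qed ((simp only: dist_ell2_def norm_ell2_def sgn_ell2_def uniformity_ell2_def open_ell2_def; fail)
    | (transfer, simp add: algebra_simps; fail))+

end

lift_definition cinner :: "'a ell2 \<Rightarrow> 'a ell2 \<Rightarrow> complex"
  is "\<lambda>f g. \<Sum>\<^sub>\<infinity>x. cnj (f x) * g x" .

lift_definition ket :: "'a \<Rightarrow> 'a ell2" is "\<lambda>x y. of_bool (x = y)"
proof -
  fix x :: 'a
  have "(\<lambda>y. (cmod (of_bool (x = y)))\<^sup>2) summable_on {x}" by simp
  then show "(\<lambda>y. (cmod (of_bool (x = y)))\<^sup>2) summable_on UNIV"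
    by (rule summable_on_cong_neutral[THEN iffD1, rotated -1]) auto
qed

lift_definition tensor_ell2 :: "'a ell2 \<Rightarrow> 'b ell2 \<Rightarrow> ('a \<times> 'b) ell2"  (infixr \<open>\<otimes>\<^sub>2\<close> 70)
  is "\<lambda>f g (x, y). f x * g y"
proof -
  fix f :: "'a \<Rightarrow> complex" and g :: "'b \<Rightarrow> complex"
  assume f: "(\<lambda>x. (cmod (f x))\<^sup>2) summable_on UNIV" and g: "(\<lambda>x. (cmod (g x))\<^sup>2) summable_on UNIV"
  have "(\<lambda>(x, y). (cmod (f x))\<^sup>2 * (cmod (g y))\<^sup>2) summable_on UNIV \<times> UNIV"
    by (rule summable_on_SigmaI[where g = "\<lambda>x. (cmod (f x))\<^sup>2 * (\<Sum>\<^sub>\<infinity>y. (cmod (g y))\<^sup>2)"])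
       (auto intro!: has_sum_cmult_right has_sum_infsum summable_on_cmult_left f g)
  then show "(\<lambda>z. (cmod (case z of (x, y) \<Rightarrow> f x * g y))\<^sup>2) summable_on UNIV"
    by (simp add: case_prod_unfold norm_mult power_mult_distrib)
qed

lemma ell2_eqI: "(\<And>x. ell2_fun f x = ell2_fun g x) \<Longrightarrow> f = g"
  by (simp add: ell2_fun_inject[symmetric] fun_eq_iff)

lemma ell2_summable: "(\<lambda>x. (cmod (ell2_fun f x))\<^sup>2) summable_on A"
  using ell2_fun[of f] by (auto intro: summable_on_subset)

lemma cinner_summable: "(\<lambda>x. cnj (ell2_fun f x) * ell2_fun g x) summable_on A"
  by (rule ell2_cinner_summable) (rule ell2_summable)+

lemma norm_ell2_power2: "(norm f)\<^sup>2 = (\<Sum>\<^sub>\<infinity>x. (cmod (ell2_fun f x))\<^sup>2)"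
proof -
  have "(\<Sum>\<^sub>\<infinity>x. cnj (ell2_fun f x) * ell2_fun f x) = (\<Sum>\<^sub>\<infinity>x. complex_of_real ((cmod (ell2_fun f x))\<^sup>2))"
    by (intro infsum_cong) (metis complex_norm_square mult.commute)
  also have "\<dots> = complex_of_real (\<Sum>\<^sub>\<infinity>x. (cmod (ell2_fun f x))\<^sup>2)"
    by (intro infsumI has_sum_of_real has_sum_infsum ell2_summable)
  finally show ?thesis by (simp add: power2_norm_eq_inner inner_ell2.rep_eq)
qed

lemma inner_ell2_cinner: "inner f g = Re (cinner f g)"
  by transfer simp

lemma cinner_commute: "cinner g f = cnj (cinner f g)"
  by transfer (simp flip: infsum_cnj add: mult.commute)

lemma cinner_add_right: "cinner f (g + h) = cinner f g + cinner f h"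
  by (simp add: cinner.rep_eq plus_ell2.rep_eq distrib_left infsum_add cinner_summable)

lemma cinner_add_left: "cinner (f + g) h = cinner f h + cinner g h"
  by (simp add: cinner.rep_eq plus_ell2.rep_eq distrib_right infsum_add cinner_summable)

lemma cinner_scaleC_right: "cinner f (c *\<^sub>C g) = c * cinner f g"
proof -
  have "cinner f (c *\<^sub>C g) = (\<Sum>\<^sub>\<infinity>x. c * (cnj (ell2_fun f x) * ell2_fun g x))"
    by (simp add: cinner.rep_eq scaleC.rep_eq mult.left_commute)
  then show ?thesis by (simp add: cinner.rep_eq infsum_cmult_right')
qed

lemma cinner_scaleC_left: "cinner (c *\<^sub>C f) g = cnj c * cinner f g"
  by (subst (1 2) cinner_commute) (simp add: cinner_scaleC_right)

lemma scaleR_scaleC: "r *\<^sub>R f = complex_of_real r *\<^sub>C f"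
  by transfer simp

lemma scaleC_scaleC: "b *\<^sub>C c *\<^sub>C f = (b * c) *\<^sub>C f"
  by transfer (simp add: mult.assoc)

lemma scaleC_add: "c *\<^sub>C (f + g) = c *\<^sub>C f + c *\<^sub>C g"
  by transfer (simp add: distrib_left)

lemma norm_scaleC: "norm (c *\<^sub>C f) = cmod c * norm f"
proof -
  have "(norm (c *\<^sub>C f))\<^sup>2 = (cmod c * norm f)\<^sup>2"
    by (simp add: norm_ell2_power2 scaleC.rep_eq norm_mult power_mult_distrib infsum_cmult_right')
  then show ?thesis by simp
qed

lemma cinner_Cauchy_Schwarz: "cmod (cinner f g) \<le> norm f * norm g"
proof (cases "cinner f g = 0")
  case False
  define c where "c = cnj (sgn (cinner f g))"
  have c: "cmod c = 1" using False by (simp add: c_def norm_sgn)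
  have "c * cinner f g = (cinner f g * cnj (cinner f g)) / cmod (cinner f g)"
    by (simp add: c_def sgn_div_norm scaleR_conv_of_real field_simps)
  also have "\<dots> = cmod (cinner f g)"
    unfolding complex_norm_square[symmetric] using False by (simp add: power2_eq_square)
  finally have "cmod (cinner f g) = Re (cinner f (c *\<^sub>C g))"
    by (simp add: cinner_scaleC_right)
  also have "\<dots> \<le> norm f * norm (c *\<^sub>C g)"
    unfolding inner_ell2_cinner[symmetric] by (rule norm_cauchy_schwarz)
  finally show ?thesis by (simp add: norm_scaleC c)
qed simp

lemma cinner_ket: "cinner (ket x) f = ell2_fun f x"
proof -
  have "cinner (ket x) f = (\<Sum>\<^sub>\<infinity>y\<in>{x}. cnj (ell2_fun (ket x) y) * ell2_fun f y)"
    unfolding cinner.rep_eq by (rule infsum_cong_neutral) (auto simp: ket.rep_eq)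
  then show ?thesis by (simp add: ket.rep_eq)
qed

lemma ell2_fun_sum: "ell2_fun (sum h F) x = (\<Sum>i\<in>F. ell2_fun (h i) x)"
  by (induction F rule: infinite_finite_induct) (auto simp: zero_ell2.rep_eq plus_ell2.rep_eq)

lemma ell2_has_sum_ket: "((\<lambda>x. ell2_fun f x *\<^sub>C ket x) has_sum f) UNIV"
proof -
  define S where "S F = (\<Sum>x\<in>F. ell2_fun f x *\<^sub>C ket x)" for F
  define N where "N = (\<Sum>\<^sub>\<infinity>x. (cmod (ell2_fun f x))\<^sup>2)"
  have eq: "norm (S F - f) = sqrt (N - (\<Sum>x\<in>F. (cmod (ell2_fun f x))\<^sup>2))" if "finite F" for F
  proof -
    have S: "ell2_fun (S F) x = (if x \<in> F then ell2_fun f x else 0)" for x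
      using that by (simp add: S_def ell2_fun_sum scaleC.rep_eq ket.rep_eq of_bool_def if_distrib sum.delta cong: if_cong)
    have "(norm (S F - f))\<^sup>2 = (\<Sum>\<^sub>\<infinity>x\<in>-F. (cmod (ell2_fun f x))\<^sup>2)"
      unfolding norm_ell2_power2 by (rule infsum_cong_neutral) (auto simp: minus_ell2.rep_eq S)
    moreover have "N = (\<Sum>\<^sub>\<infinity>x\<in>F \<union> -F. (cmod (ell2_fun f x))\<^sup>2)" by (simp add: N_def)
    then have "N = (\<Sum>x\<in>F. (cmod (ell2_fun f x))\<^sup>2) + (\<Sum>\<^sub>\<infinity>x\<in>-F. (cmod (ell2_fun f x))\<^sup>2)"
      using that by (subst (asm) infsum_Un_disjoint) (auto intro: ell2_summable)
    ultimately show ?thesis by (metis add_diff_cancel_left' norm_ge_zero real_sqrt_abs abs_of_nonneg)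
  qed
  have "((\<lambda>F. \<Sum>x\<in>F. (cmod (ell2_fun f x))\<^sup>2) \<longlongrightarrow> N) (finite_subsets_at_top UNIV)"
    using has_sum_infsum[OF ell2_summable[of f UNIV]] by (simp add: has_sum_def N_def)
  then have "((\<lambda>F. sqrt (N - (\<Sum>x\<in>F. (cmod (ell2_fun f x))\<^sup>2))) \<longlongrightarrow> sqrt (N - N)) (finite_subsets_at_top UNIV)"
    by (intro tendsto_intros)
  moreover have "\<forall>\<^sub>F F in finite_subsets_at_top UNIV.
      sqrt (N - (\<Sum>x\<in>F. (cmod (ell2_fun f x))\<^sup>2)) = norm (S F - f)"
    by (rule eventually_finite_subsets_at_top_weakI) (simp add: eq)
  ultimately have "((\<lambda>F. norm (S F - f)) \<longlongrightarrow> 0) (finite_subsets_at_top UNIV)"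
    by (simp add: tendsto_cong)
  then show ?thesis
    by (simp add: has_sum_def S_def[abs_def] LIM_zero_iff tendsto_norm_zero_iff)
qed

type_synonym 'a op = "'a ell2 \<Rightarrow> 'a ell2"

definition bounded_op :: "('a ell2 \<Rightarrow> 'b ell2) \<Rightarrow> bool" where
  "bounded_op T \<longleftrightarrow> bounded_linear T \<and> (\<forall>c f. T (c *\<^sub>C f) = c *\<^sub>C T f)"

lemma bounded_opI:
  assumes "\<And>f g. T (f + g) = T f + T g" "\<And>c f. T (c *\<^sub>C f) = c *\<^sub>C T f"
    and "\<And>f. norm (T f) \<le> K * norm f"
  shows "bounded_op T"
  unfolding bounded_op_def using assms
  by (auto intro!: bounded_linear_intro[where K = K] simp: scaleR_scaleC mult.commute)

lemma bounded_op_eqI: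
  assumes "bounded_op S" "bounded_op T" "\<And>x. S (ket x) = T (ket x)"
  shows "S = T"
proof
  fix f
  have "((\<lambda>x. S (ell2_fun f x *\<^sub>C ket x)) has_sum S f) UNIV"
    "((\<lambda>x. T (ell2_fun f x *\<^sub>C ket x)) has_sum T f) UNIV"
    using assms ell2_has_sum_ket[of f] unfolding bounded_op_def
    by (auto dest: has_sum_bounded_linear)
  then show "S f = T f"
    using assms by (auto simp: bounded_op_def intro: has_sum_unique)
qed

text \<open>Multiplication in \<open>\<B>(\<L>\<^sup>2)\<close> is \<open>(\<circ>)\<close> and the unit is \<open>id\<close>.\<close>

definition adj :: "('a ell2 \<Rightarrow> 'b ell2) \<Rightarrow> 'b ell2 \<Rightarrow> 'a ell2" where
  "adj T = (THE T'. bounded_op T' \<and> (\<forall>f g. cinner (T' f) g = cinner f (T g)))"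

definition tensor_op :: "'a op \<Rightarrow> 'b op \<Rightarrow> ('a \<times> 'b) op"  (infixr \<open>\<otimes>\<^sub>o\<close> 70) where
  "a \<otimes>\<^sub>o b = (THE T. bounded_op T \<and> (\<forall>f g. T (f \<otimes>\<^sub>2 g) = a f \<otimes>\<^sub>2 b g))"

lemma bounded_op_bound:
  assumes "bounded_op T"
  shows "\<exists>K\<ge>0. \<forall>f. norm (T f) \<le> K * norm f"
  using assms bounded_linear.nonneg_bounded[of T] by (auto simp: bounded_op_def mult.commute)

lemma bounded_op_simps:
  assumes "bounded_op T"
  shows "T (f + g) = T f + T g" "T (c *\<^sub>C f) = c *\<^sub>C T f" "T 0 = 0"
    "T (sum h F) = (\<Sum>x\<in>F. T (h x))"
  using assms by (auto simp: bounded_op_def linear_simps bounded_linear.linear linear_sum)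

lemma ell2_norm_le:
  assumes "\<And>F. finite F \<Longrightarrow> (\<Sum>x\<in>F. (cmod (ell2_fun f x))\<^sup>2) \<le> K\<^sup>2" "K \<ge> 0"
  shows "norm f \<le> K"
proof -
  have "(norm f)\<^sup>2 \<le> K\<^sup>2"
    unfolding norm_ell2_power2 by (rule infsum_le_finite_sums[OF ell2_summable]) (use assms in auto)
  then show ?thesis using assms(2) by (simp add: power2_le_iff_abs_le)
qed

lemma sum_le_norm_ell2: "finite F \<Longrightarrow> (\<Sum>x\<in>F. (cmod (ell2_fun f x))\<^sup>2) \<le> (norm f)\<^sup>2"
  unfolding norm_ell2_power2 by (rule finite_sum_le_infsum[OF ell2_summable]) auto

lemma adj_unique_exists:
  assumes T: "bounded_op T"
  shows "\<exists>!T'. bounded_op T' \<and> (\<forall>f g. cinner (T' f) g = cinner f (T g))"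
proof -
  obtain K where K: "K \<ge> 0" "\<And>f. norm (T f) \<le> K * norm f" using bounded_op_bound[OF T] by blast
  define A where "A f x = cinner (T (ket x)) f" for f x
  have bound: "(\<Sum>x\<in>F. (cmod (A f x))\<^sup>2) \<le> (K * norm f)\<^sup>2" if F: "finite F" for f F
  proof -
    define g where "g = (\<Sum>x\<in>F. A f x *\<^sub>C ket x)"
    define S where "S = (\<Sum>x\<in>F. (cmod (A f x))\<^sup>2)"
    have g: "ell2_fun g x = (if x \<in> F then A f x else 0)" for x
      using F by (simp add: g_def ell2_fun_sum scaleC.rep_eq ket.rep_eq of_bool_def if_distrib sum.delta cong: if_cong)
    have S0: "S \<ge> 0" unfolding S_def by (simp add: sum_nonneg)
    have ng: "norm g \<le> sqrt S"
    proof (rule ell2_norm_le)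
      fix F' :: "'a set" assume "finite F'"
      then have "(\<Sum>x\<in>F'. (cmod (ell2_fun g x))\<^sup>2) = (\<Sum>x\<in>F' \<inter> F. (cmod (A f x))\<^sup>2)"
        by (simp add: g if_distrib sum.inter_restrict[symmetric] cong: if_cong)
           (auto simp: sum.inter_restrict intro!: sum.cong)
      also have "\<dots> \<le> S" unfolding S_def using F by (intro sum_mono2) auto
      finally show "(\<Sum>x\<in>F'. (cmod (ell2_fun g x))\<^sup>2) \<le> (sqrt S)\<^sup>2" using S0 by simp
    qed (use S0 in auto)
    have sl: "cinner (sum h F) f = (\<Sum>x\<in>F. cinner (h x) f)" for h :: "'a \<Rightarrow> 'b ell2"
      using F by (induction F) (auto simp: cinner_add_left, simp add: cinner.rep_eq zero_ell2.rep_eq)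
    have "complex_of_real S = (\<Sum>x\<in>F. cnj (A f x) * A f x)"
      unfolding S_def of_real_sum by (intro sum.cong refl) (metis complex_norm_square mult.commute)
    also have "\<dots> = cinner (T g) f"
      using T by (simp add: g_def bounded_op_simps sl cinner_scaleC_left A_def)
    finally have "S \<le> cmod (cinner (T g) f)"
      by (metis S0 norm_of_real abs_of_nonneg order_refl)
    also have "\<dots> \<le> norm (T g) * norm f" by (rule cinner_Cauchy_Schwarz)
    also have "\<dots> \<le> (K * sqrt S) * norm f"
      by (intro mult_right_mono order_trans[OF K(2)] mult_left_mono ng K) auto
    finally have "sqrt S * sqrt S \<le> (K * norm f) * sqrt S" using S0 by (simp add: ac_simps)
    then have "sqrt S \<le> K * norm f"
      by (cases "S = 0") (use S0 K in \<open>auto simp del: real_sqrt_mult_self intro: mult_right_le_imp_le\<close>)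
    then show ?thesis unfolding S_def[symmetric] using S0
      by (metis power_mono real_sqrt_ge_0_iff real_sqrt_pow2)
  qed
  define T' where "T' f = Abs_ell2 (A f)" for f
  have T': "ell2_fun (T' f) = A f" for f
    unfolding T'_def
  proof (rule Abs_ell2_inverse, clarify, rule nonneg_bdd_above_summable_on)
    show "bdd_above (sum (\<lambda>x. (cmod (A f x))\<^sup>2) ` {F. F \<subseteq> UNIV \<and> finite F})"
      using bound by (auto intro!: bdd_aboveI)
  qed simp
  have "bounded_op T'"
    by (rule bounded_opI[where K = K])
       (auto intro!: ell2_eqI ell2_norm_le mult_nonneg_nonneg K bound
         simp: T' A_def plus_ell2.rep_eq scaleC.rep_eq cinner_add_right cinner_scaleC_right
           bound[unfolded A_def])
  moreover have "cinner (T' f) g = cinner f (T g)" for f g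
  proof -
    have bl: "bounded_linear (cinner h)" for h :: "'c ell2"
      by (rule bounded_linear_intro[where K = "norm h"])
         (use cinner_Cauchy_Schwarz[of h] in \<open>auto simp: cinner_add_right scaleR_scaleC
            cinner_scaleC_right scaleR_conv_of_real mult.commute\<close>)
    have "((\<lambda>x. ell2_fun g x * cinner (T' f) (ket x)) has_sum cinner (T' f) g) UNIV"
      using has_sum_bounded_linear[OF bl[of "T' f"] ell2_has_sum_ket[of g]]
      by (simp add: cinner_scaleC_right)
    moreover have "cinner (T' f) (ket x) = cinner f (T (ket x))" for x
      by (subst (1 2) cinner_commute) (simp add: cinner_ket T' A_def)
    moreover have "((\<lambda>x. ell2_fun g x * cinner f (T (ket x))) has_sum cinner f (T g)) UNIV"
      using has_sum_bounded_linear[OF bounded_linear_compose[OF bl[of f]] ell2_has_sum_ket[of g], of T] T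
      by (simp add: cinner_scaleC_right bounded_op_simps bounded_op_def)
    ultimately show ?thesis by (auto intro: has_sum_unique)
  qed
  moreover have "T1 = T2" if "\<forall>f g. cinner (T1 f) g = cinner f (T g)" "\<forall>f g. cinner (T2 f) g = cinner f (T g)"
    for T1 T2
  proof (intro ext ell2_eqI)
    fix f x
    have "cinner (ket x) (T1 f) = cinner (ket x) (T2 f)"
      using that by (metis cinner_commute)
    then show "ell2_fun (T1 f) x = ell2_fun (T2 f) x" by (simp add: cinner_ket)
  qed
  ultimately show ?thesis by blast
qed

lemma adj:
  assumes "bounded_op T"
  shows "bounded_op (adj T)" "cinner (adj T f) g = cinner f (T g)"
  using theI'[OF adj_unique_exists[OF assms]] by (auto simp: adj_def)

lift_definition slice_ell2 :: "('a \<times> 'b) ell2 \<Rightarrow> 'a \<Rightarrow> 'b ell2" is "\<lambda>F x y. F (x, y)"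
proof -
  fix F :: "'a \<times> 'b \<Rightarrow> complex" and x
  assume "(\<lambda>z. (cmod (F z))\<^sup>2) summable_on UNIV"
  then have "(\<lambda>z. (cmod (F z))\<^sup>2) summable_on Pair x ` UNIV"
    by (rule summable_on_subset) simp
  then show "(\<lambda>y. (cmod (F (x, y)))\<^sup>2) summable_on UNIV"
    by (simp add: summable_on_reindex inj_on_def o_def)
qed

lift_definition swap_ell2 :: "('a \<times> 'b) ell2 \<Rightarrow> ('b \<times> 'a) ell2" is "\<lambda>F (y, x). F (x, y)"
  by (subst summable_on_reindex_bij_betw[where g = prod.swap, symmetric])
     (simp_all add: bij_swap case_prod_unfold)

lemma sum_norm_slice_ell2:
  assumes "finite A"
  shows "(\<Sum>x\<in>A. (norm (slice_ell2 F x))\<^sup>2) \<le> (norm F)\<^sup>2"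
proof -
  have "((\<lambda>z. (cmod (ell2_fun F z))\<^sup>2) has_sum (norm F)\<^sup>2) (Sigma UNIV (\<lambda>_. UNIV))"
    using has_sum_infsum[OF ell2_summable[of F UNIV]] by (simp add: norm_ell2_power2)
  then have "((\<lambda>x. (norm (slice_ell2 F x))\<^sup>2) has_sum (norm F)\<^sup>2) UNIV"
    by (rule has_sum_SigmaD)
       (use has_sum_infsum[OF ell2_summable[of "slice_ell2 F _" UNIV]] in
        \<open>simp add: norm_ell2_power2 slice_ell2.rep_eq\<close>)
  then show ?thesis using assms by (intro finite_sum_le_has_sum) auto
qed

lemma norm_swap_ell2: "norm (swap_ell2 F) = norm F"
proof -
  have "(norm (swap_ell2 F))\<^sup>2 = (norm F)\<^sup>2"
    unfolding norm_ell2_power2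
    by (subst infsum_reindex_bij_betw[where g = prod.swap, symmetric])
       (simp_all add: bij_swap swap_ell2.rep_eq case_prod_unfold)
  then show ?thesis by simp
qed

lemma bounded_op_swap: "bounded_op swap_ell2"
  by (rule bounded_opI[where K = 1])
     (auto simp: norm_swap_ell2 intro!: ell2_eqI simp: swap_ell2.rep_eq plus_ell2.rep_eq scaleC.rep_eq)

lemma bounded_op_comp: "bounded_op S \<Longrightarrow> bounded_op T \<Longrightarrow> bounded_op (S \<circ> T)"
  unfolding bounded_op_def o_def by (auto intro: bounded_linear_compose)

lemma tensor_id_exists:
  fixes b :: "'b op"
  assumes b: "bounded_op b"
  shows "\<exists>T :: ('a \<times> 'b) op. bounded_op T \<and> (\<forall>f g. T (f \<otimes>\<^sub>2 g) = f \<otimes>\<^sub>2 b g)"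
proof -
  obtain K where K: "K \<ge> 0" "\<And>f. norm (b f) \<le> K * norm f" using bounded_op_bound[OF b] by blast
  define B :: "('a \<times> 'b) ell2 \<Rightarrow> 'a \<times> 'b \<Rightarrow> complex"
    where "B F z = ell2_fun (b (slice_ell2 F (fst z))) (snd z)" for F z
  have bound: "(\<Sum>z\<in>X. (cmod (B F z))\<^sup>2) \<le> (K * norm F)\<^sup>2" if X: "finite X" for X F
  proof -
    have "(\<Sum>z\<in>X. (cmod (B F z))\<^sup>2) \<le> (\<Sum>z\<in>fst ` X \<times> snd ` X. (cmod (B F z))\<^sup>2)"
      using X by (intro sum_mono2) force+
    also have "\<dots> = (\<Sum>x\<in>fst ` X. \<Sum>y\<in>snd ` X. (cmod (ell2_fun (b (slice_ell2 F x)) y))\<^sup>2)"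
      by (simp add: sum.cartesian_product case_prod_unfold B_def)
    also have "\<dots> \<le> (\<Sum>x\<in>fst ` X. (K * norm (slice_ell2 F x))\<^sup>2)"
      using X by (intro sum_mono order_trans[OF sum_le_norm_ell2] power_mono K) auto
    also have "\<dots> \<le> (K * norm F)\<^sup>2"
      using X by (simp add: power_mult_distrib sum_distrib_left[symmetric] mult_left_mono sum_norm_slice_ell2)
    finally show ?thesis .
  qed
  define T where "T F = Abs_ell2 (B F)" for F
  have T: "ell2_fun (T F) = B F" for F
    unfolding T_def
  proof (rule Abs_ell2_inverse, clarify, rule nonneg_bdd_above_summable_on)
    show "bdd_above (sum (\<lambda>x. (cmod (B F x))\<^sup>2) ` {X. X \<subseteq> UNIV \<and> finite X})"
      using bound by (auto intro!: bdd_aboveI)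
  qed simp
  have sl: "slice_ell2 (F + G) x = slice_ell2 F x + slice_ell2 G x"
    "slice_ell2 (c *\<^sub>C F) x = c *\<^sub>C slice_ell2 F x"
    "slice_ell2 (f \<otimes>\<^sub>2 g) x = ell2_fun f x *\<^sub>C g"
    for F G :: "('a \<times> 'b) ell2" and c x f g
    by (auto intro!: ell2_eqI simp: slice_ell2.rep_eq plus_ell2.rep_eq scaleC.rep_eq tensor_ell2.rep_eq)
  have "bounded_op T"
    by (rule bounded_opI[where K = K])
       (auto intro!: ell2_eqI ell2_norm_le mult_nonneg_nonneg K
         simp: T B_def sl bounded_op_simps[OF b] plus_ell2.rep_eq scaleC.rep_eq bound[unfolded B_def])
  moreover have "T (f \<otimes>\<^sub>2 g) = f \<otimes>\<^sub>2 b g" for f g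
    by (auto intro!: ell2_eqI simp: T B_def sl bounded_op_simps[OF b] scaleC.rep_eq tensor_ell2.rep_eq)
  ultimately show ?thesis by blast
qed

lemma tensor_op_unique_exists:
  fixes a :: "'a op" and b :: "'b op"
  assumes "bounded_op a" "bounded_op b"
  shows "\<exists>!T. bounded_op T \<and> (\<forall>f g. T (f \<otimes>\<^sub>2 g) = a f \<otimes>\<^sub>2 b g)"
proof -
  obtain A :: "('b \<times> 'a) op" and B :: "('a \<times> 'b) op" where A: "bounded_op A" "\<And>f g. A (f \<otimes>\<^sub>2 g) = f \<otimes>\<^sub>2 a g"
    and B: "bounded_op B" "\<And>f g. B (f \<otimes>\<^sub>2 g) = f \<otimes>\<^sub>2 b g"
    using tensor_id_exists[OF assms(1)] tensor_id_exists[OF assms(2)] by blast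
  have sw: "swap_ell2 (f \<otimes>\<^sub>2 g) = g \<otimes>\<^sub>2 f" for f :: "'c ell2" and g :: "'d ell2"
    by (auto intro!: ell2_eqI simp: swap_ell2.rep_eq tensor_ell2.rep_eq)
  have ket: "ket z = ket (fst z) \<otimes>\<^sub>2 ket (snd z)" for z :: "'c \<times> 'd"
    by (auto intro!: ell2_eqI simp: ket.rep_eq tensor_ell2.rep_eq prod_eq_iff)
  have "bounded_op (swap_ell2 \<circ> A \<circ> swap_ell2 \<circ> B)"
    by (intro bounded_op_comp bounded_op_swap A B)
  moreover have "(swap_ell2 \<circ> A \<circ> swap_ell2 \<circ> B) (f \<otimes>\<^sub>2 g) = a f \<otimes>\<^sub>2 b g" for f g
    by (simp add: A B sw)
  moreover have "T1 = T2"
    if "bounded_op T1 \<and> (\<forall>f g. T1 (f \<otimes>\<^sub>2 g) = a f \<otimes>\<^sub>2 b g)"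
      "bounded_op T2 \<and> (\<forall>f g. T2 (f \<otimes>\<^sub>2 g) = a f \<otimes>\<^sub>2 b g)" for T1 T2
    using that by (intro bounded_op_eqI) (auto simp: ket)
  ultimately show ?thesis by blast
qed

lemma tensor_op:
  assumes "bounded_op a" "bounded_op b"
  shows "bounded_op (a \<otimes>\<^sub>o b)" "(a \<otimes>\<^sub>o b) (f \<otimes>\<^sub>2 g) = a f \<otimes>\<^sub>2 b g"
  using theI'[OF tensor_op_unique_exists[OF assms]] by (auto simp: tensor_op_def)

definition commutant :: "'a op set \<Rightarrow> 'a op set" where
  "commutant M = {T. bounded_op T \<and> (\<forall>S\<in>M. T \<circ> S = S \<circ> T)}"

text \<open>
  Weak convergence of (unordered) sums of operators and of vectors. Since \<open>has_sum\<close> is convergence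
  along the net of finite subsets, this is unconditional convergence.
\<close>

definition wot_has_sum :: "('i \<Rightarrow> 'a op) \<Rightarrow> 'a op \<Rightarrow> bool" where
  "wot_has_sum T a \<longleftrightarrow> (\<forall>f g. ((\<lambda>i. cinner f (T i g)) has_sum cinner f (a g)) UNIV)"

definition weak_has_sum :: "('i \<Rightarrow> 'a ell2) \<Rightarrow> 'a ell2 \<Rightarrow> bool" where
  "weak_has_sum h g \<longleftrightarrow> (\<forall>f. ((\<lambda>i. cinner f (h i)) has_sum cinner f g) UNIV)"

text \<open>
  A groupoid is given by its structure maps; transitions and outcomes are the elements of the types
  \<open>'g\<close> and \<open>'x\<close>. The value \<open>gcomp G \<alpha> \<beta>\<close> (first \<open>\<beta>\<close>, then \<open>\<alpha>\<close>) is meaningful only if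
  \<open>src G \<alpha> = tgt G \<beta>\<close>.
\<close>

record ('g, 'x) groupoid =
  src :: "'g \<Rightarrow> 'x"
  tgt :: "'g \<Rightarrow> 'x"
  gcomp :: "'g \<Rightarrow> 'g \<Rightarrow> 'g"
  gunit :: "'x \<Rightarrow> 'g"
  ginv :: "'g \<Rightarrow> 'g"

definition is_groupoid :: "('g, 'x) groupoid \<Rightarrow> bool" where
  "is_groupoid G \<longleftrightarrow>
    (\<forall>x. src G (gunit G x) = x \<and> tgt G (gunit G x) = x) \<and>
    (\<forall>\<alpha> \<beta>. src G \<alpha> = tgt G \<beta> \<longrightarrow>
      src G (gcomp G \<alpha> \<beta>) = src G \<beta> \<and> tgt G (gcomp G \<alpha> \<beta>) = tgt G \<alpha>) \<and>
    (\<forall>\<alpha> \<beta> \<gamma>. src G \<alpha> = tgt G \<beta> \<and> src G \<beta> = tgt G \<gamma> \<longrightarrow>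
      gcomp G (gcomp G \<alpha> \<beta>) \<gamma> = gcomp G \<alpha> (gcomp G \<beta> \<gamma>)) \<and>
    (\<forall>\<alpha>. gcomp G \<alpha> (gunit G (src G \<alpha>)) = \<alpha> \<and> gcomp G (gunit G (tgt G \<alpha>)) \<alpha> = \<alpha>) \<and>
    (\<forall>\<alpha>. src G (ginv G \<alpha>) = tgt G \<alpha> \<and> tgt G (ginv G \<alpha>) = src G \<alpha> \<and>
      gcomp G (ginv G \<alpha>) \<alpha> = gunit G (src G \<alpha>) \<and> gcomp G \<alpha> (ginv G \<alpha>) = gunit G (tgt G \<alpha>))"

definition totally_disconnected :: "('g, 'x) groupoid \<Rightarrow> bool" where
  "totally_disconnected G \<longleftrightarrow> (\<forall>\<alpha>. src G \<alpha> = tgt G \<alpha>)"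

definition connected_groupoid :: "('g, 'x) groupoid \<Rightarrow> bool" where
  "connected_groupoid G \<longleftrightarrow> (\<forall>x y. \<exists>\<alpha>. src G \<alpha> = x \<and> tgt G \<alpha> = y)"

definition prod_groupoid ::
    "('g, 'x) groupoid \<Rightarrow> ('h, 'y) groupoid \<Rightarrow> ('g \<times> 'h, 'x \<times> 'y) groupoid"  (infixr \<open>\<times>\<^sub>G\<close> 80) where
  "G \<times>\<^sub>G K =
    \<lparr>src = map_prod (src G) (src K),
     tgt = map_prod (tgt G) (tgt K),
     gcomp = (\<lambda>(\<alpha>, \<beta>) (\<alpha>', \<beta>'). (gcomp G \<alpha> \<alpha>', gcomp K \<beta> \<beta>')),
     gunit = map_prod (gunit G) (gunit K),
     ginv = map_prod (ginv G) (ginv K)\<rparr>"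

text \<open>
  Elements of the algebra of transitions are their finitely supported coefficient functions.
\<close>

definition transition_algebra :: "('g, 'x) groupoid \<Rightarrow> ('g \<Rightarrow> complex) set" where
  "transition_algebra G = {A. finite {\<alpha>. A \<alpha> \<noteq> 0}}"

definition transition :: "'g \<Rightarrow> 'g \<Rightarrow> complex" where
  "transition \<alpha> \<beta> = of_bool (\<alpha> = \<beta>)"

definition left_regular :: "('g, 'x) groupoid \<Rightarrow> ('g \<Rightarrow> complex) \<Rightarrow> 'g op" where
  "left_regular G A \<Psi> = Abs_ell2 (\<lambda>\<beta>.
     \<Sum>\<alpha> | A \<alpha> \<noteq> 0 \<and> tgt G \<alpha> = tgt G \<beta>. A \<alpha> * ell2_fun \<Psi> (gcomp G (ginv G \<alpha>) \<beta>))"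

lemma ell2_fun_left_regular:
  assumes G: "is_groupoid G" and A: "A \<in> transition_algebra G"
  shows "ell2_fun (left_regular G A \<Psi>) \<beta> =
    (\<Sum>\<alpha> | A \<alpha> \<noteq> 0 \<and> tgt G \<alpha> = tgt G \<beta>. A \<alpha> * ell2_fun \<Psi> (gcomp G (ginv G \<alpha>) \<beta>))"
proof -
  define h where "h \<alpha> \<beta> = (if tgt G \<alpha> = tgt G \<beta> then A \<alpha> * ell2_fun \<Psi> (gcomp G (ginv G \<alpha>) \<beta>) else 0)" for \<alpha> \<beta>
  have fin: "finite {\<alpha>. A \<alpha> \<noteq> 0}" using A by (simp add: transition_algebra_def)
  have h: "(\<lambda>\<beta>. (cmod (h \<alpha> \<beta>))\<^sup>2) summable_on UNIV" for \<alpha>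
  proof -
    have inj: "inj_on (gcomp G (ginv G \<alpha>)) {\<beta>. tgt G \<alpha> = tgt G \<beta>}"
    proof (rule inj_on_inverseI[where g = "gcomp G \<alpha>"])
      fix \<beta> assume "\<beta> \<in> {\<beta>. tgt G \<alpha> = tgt G \<beta>}"
      then have b: "tgt G \<alpha> = tgt G \<beta>" by simp
      have "gcomp G \<alpha> (gcomp G (ginv G \<alpha>) \<beta>) = gcomp G (gcomp G \<alpha> (ginv G \<alpha>)) \<beta>"
        using G b unfolding is_groupoid_def by metis
      also have "\<dots> = \<beta>" using G b unfolding is_groupoid_def by metis
      finally show "gcomp G \<alpha> (gcomp G (ginv G \<alpha>) \<beta>) = \<beta>" .
    qed
    have "(\<lambda>\<beta>. (cmod (ell2_fun \<Psi> (gcomp G (ginv G \<alpha>) \<beta>)))\<^sup>2) summable_on {\<beta>. tgt G \<alpha> = tgt G \<beta>}"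
      using summable_on_reindex[OF inj, of "\<lambda>\<beta>. (cmod (ell2_fun \<Psi> \<beta>))\<^sup>2"]
      by (simp add: o_def ell2_summable)
    then have "(\<lambda>\<beta>. (cmod (A \<alpha> * ell2_fun \<Psi> (gcomp G (ginv G \<alpha>) \<beta>)))\<^sup>2) summable_on {\<beta>. tgt G \<alpha> = tgt G \<beta>}"
      by (rule ell2_cmult_summable)
    then show ?thesis
      by (rule summable_on_cong_neutral[THEN iffD1, rotated -1]) (auto simp: h_def)
  qed
  have "(\<lambda>\<beta>. (cmod (\<Sum>\<alpha>\<in>F. h \<alpha> \<beta>))\<^sup>2) summable_on UNIV" if "finite F" for F
    using that by (induction F rule: finite_induct) (auto intro: ell2_add_summable h)
  from this[OF fin] have "(\<lambda>\<beta>. (cmod (\<Sum>\<alpha> | A \<alpha> \<noteq> 0 \<and> tgt G \<alpha> = tgt G \<beta>.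
      A \<alpha> * ell2_fun \<Psi> (gcomp G (ginv G \<alpha>) \<beta>)))\<^sup>2) summable_on UNIV"
    using fin by (simp add: h_def sum.If_cases Int_def)
  then show ?thesis unfolding left_regular_def by (subst Abs_ell2_inverse) auto
qed

definition vN_algebra :: "('g, 'x) groupoid \<Rightarrow> 'g op set"  (\<open>\<V>\<close>) where
  "\<V> G = commutant (commutant (left_regular G ` transition_algebra G))"

text \<open>
  The fundamental representation, a datum on \<open>\<V> G\<close>: a \<open>*\<close>-representation on \<open>L\<^sup>2(\<Omega>)\<close> which has the
  prescribed values on transitions, and which is evaluated termwise on basis vectors at every element
  that is given by a weakly convergent expansion into transitions.
\<close>

definition star_representation :: "'a op set \<Rightarrow> ('a op \<Rightarrow> 'b op) \<Rightarrow> bool" where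
  "star_representation M \<pi> \<longleftrightarrow>
    (\<forall>a\<in>M. bounded_op (\<pi> a)) \<and>
    (\<forall>a\<in>M. \<forall>b\<in>M. \<pi> (\<lambda>\<Psi>. a \<Psi> + b \<Psi>) = (\<lambda>\<Psi>. \<pi> a \<Psi> + \<pi> b \<Psi>)) \<and>
    (\<forall>a\<in>M. \<forall>c. \<pi> (\<lambda>\<Psi>. c *\<^sub>C a \<Psi>) = (\<lambda>\<Psi>. c *\<^sub>C \<pi> a \<Psi>)) \<and>
    (\<forall>a\<in>M. \<forall>b\<in>M. \<pi> (a \<circ> b) = \<pi> a \<circ> \<pi> b) \<and>
    (\<forall>a\<in>M. \<pi> (adj a) = adj (\<pi> a))"

definition fundamental_representation :: "('g, 'x) groupoid \<Rightarrow> ('g op \<Rightarrow> 'x op) \<Rightarrow> bool" where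
  "fundamental_representation G \<pi> \<longleftrightarrow>
    star_representation (\<V> G) \<pi> \<and>
    (\<forall>\<alpha> x. \<pi> (left_regular G (transition \<alpha>)) (ket x) = (if x = src G \<alpha> then ket (tgt G \<alpha>) else 0)) \<and>
    (\<forall>a\<in>\<V> G. \<forall>c. wot_has_sum (\<lambda>\<alpha> \<Psi>. c \<alpha> *\<^sub>C left_regular G (transition \<alpha>) \<Psi>) a \<longrightarrow>
      (\<forall>x. weak_has_sum (\<lambda>\<alpha>. c \<alpha> *\<^sub>C \<pi> (left_regular G (transition \<alpha>)) (ket x)) (\<pi> a (ket x))))"

text \<open>
  Functionals on an algebra \<open>M\<close> of operators are total functions of which only the values on \<open>M\<close>
  matter.
\<close>

definition state :: "'a op set \<Rightarrow> ('a op \<Rightarrow> complex) \<Rightarrow> bool" where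
  "state M \<rho> \<longleftrightarrow>
    (\<forall>a\<in>M. \<forall>b\<in>M. \<rho> (\<lambda>\<Psi>. a \<Psi> + b \<Psi>) = \<rho> a + \<rho> b) \<and>
    (\<forall>a\<in>M. \<forall>c. \<rho> (\<lambda>\<Psi>. c *\<^sub>C a \<Psi>) = c * \<rho> a) \<and>
    (\<forall>a\<in>M. \<rho> (adj a \<circ> a) \<in> \<real>\<^sub>\<ge>\<^sub>0) \<and>
    \<rho> id = 1"

definition product_state ::
    "('g, 'x) groupoid \<Rightarrow> ('h, 'y) groupoid \<Rightarrow> (('g \<times> 'h) op \<Rightarrow> complex) \<Rightarrow> bool" where
  "product_state GA GB \<rho> \<longleftrightarrow> state (\<V> (GA \<times>\<^sub>G GB)) \<rho> \<and>
    (\<exists>\<rho>A \<rho>B. state (\<V> GA) \<rho>A \<and> state (\<V> GB) \<rho>B \<and>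
      (\<forall>a\<in>\<V> GA. \<forall>b\<in>\<V> GB. \<rho> (a \<otimes>\<^sub>o b) = \<rho>A a * \<rho>B b))"

definition separable_state ::
    "('g, 'x) groupoid \<Rightarrow> ('h, 'y) groupoid \<Rightarrow> (('g \<times> 'h) op \<Rightarrow> complex) \<Rightarrow> bool" where
  "separable_state GA GB \<rho> \<longleftrightarrow> state (\<V> (GA \<times>\<^sub>G GB)) \<rho> \<and>
    (\<exists>(I :: nat set) q \<sigma>.
      (\<forall>i\<in>I. 0 \<le> q i \<and> product_state GA GB (\<sigma> i)) \<and> (q has_sum (1 :: real)) I \<and>
      (\<forall>a\<in>\<V> (GA \<times>\<^sub>G GB). ((\<lambda>i. complex_of_real (q i) * \<sigma> i a) has_sum \<rho> a) I))"

definition unitary_group :: "'a op set \<Rightarrow> (real \<Rightarrow> 'a op) \<Rightarrow> bool" where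
  "unitary_group M u \<longleftrightarrow>
    (\<forall>t. u t \<in> M \<and> adj (u t) \<circ> u t = id \<and> u t \<circ> adj (u t) = id) \<and>
    u 0 = id \<and> (\<forall>s t. u (s + t) = u s \<circ> u t) \<and>
    (\<forall>\<Psi>. continuous_on UNIV (\<lambda>t. u t \<Psi>))"

text \<open>
  The graph of the (in general unbounded) self-adjoint operator \<open>H\<close> with \<open>u t = exp (\<i> t H)\<close>; by
  Stone's theorem this equation says that \<open>H\<close> is the generator of \<open>u\<close>.
\<close>

definition stone_generator :: "(real \<Rightarrow> 'a op) \<Rightarrow> ('a ell2 \<times> 'a ell2) set" where
  "stone_generator u =
    {(\<Psi>, \<Phi>). ((\<lambda>t. (1 / (\<i> * complex_of_real t)) *\<^sub>C (u t \<Psi> - \<Psi>)) \<longlongrightarrow> \<Phi>) (at 0)}"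

definition vector_functional :: "('a op \<Rightarrow> 'b op) \<Rightarrow> 'b ell2 \<Rightarrow> 'a op \<Rightarrow> complex" where
  "vector_functional \<pi> \<Psi> a = cinner \<Psi> (\<pi> a \<Psi>)"

end

theory Submission
  imports Defs
begin

text \<open>
  Since \<open>GA\<close> is totally disconnected, \<open>\<lambda>(1\<^sub>x) \<otimes> id\<close> commutes with the whole algebra, so every
  \<open>\<pi> a\<close> maps each fibre \<open>|x\<rangle> \<otimes> L\<^sup>2(\<Omega>\<^sub>B)\<close> to itself. Hence the evolution turns \<open>|x\<rangle> \<otimes> \<psi>\<close> into some
  \<open>|x\<rangle> \<otimes> \<phi>\<close>, and it remains to see that the vector states of such vectors are product states. On the
  fibre over \<open>x\<close> the operator \<open>\<pi> (a \<otimes> id)\<close> commutes with the matrix units \<open>\<pi> (1\<^sub>x \<otimes> \<beta>)\<close>; as \<open>GB\<close> is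
  connected these act irreducibly there, so \<open>\<pi> (a \<otimes> id)\<close> is a scalar and factors out of
  \<open>\<langle>x \<otimes> \<phi>, \<pi> (a \<otimes> id) \<pi> (id \<otimes> b) (x \<otimes> \<phi>)\<rangle>\<close>. Only values of \<open>\<pi>\<close> on transitions and its
  multiplicativity enter, never an infinite expansion into transitions.
\<close>

subsection \<open>Operators on \<open>\<ell>\<^sup>2\<close>\<close>

lemma ket_Pair: "ket (x, y) = ket x \<otimes>\<^sub>2 ket y"
  by (auto intro!: ell2_eqI simp: ket.rep_eq tensor_ell2.rep_eq)

lemma scaleC_0_left [simp]: "0 *\<^sub>C f = 0"
  by transfer simp

lemma scaleC_0_right [simp]: "c *\<^sub>C 0 = 0"
  by transfer simp

lemma scaleC_1_left [simp]: "1 *\<^sub>C f = f"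
  by transfer simp

lemma scaleC_add_left: "(b + c) *\<^sub>C f = b *\<^sub>C f + c *\<^sub>C f"
  by transfer (simp add: distrib_right)

lemma cinner_0_left [simp]: "cinner 0 f = 0"
  by (simp add: cinner.rep_eq zero_ell2.rep_eq)

lemma cinner_self: "cinner f f = complex_of_real ((norm f)\<^sup>2)"
proof -
  have "Im (cinner f f) = 0"
    using arg_cong[OF cinner_commute[of f f], of Im] by simp
  then show ?thesis
    by (simp add: complex_eq_iff power2_norm_eq_inner inner_ell2_cinner)
qed

lemma cinner_eqI: "(\<And>h. cinner h f = cinner h g) \<Longrightarrow> f = g"
  by (metis cinner_ket ell2_eqI)

section \<open>Tensor products of vectors\<close>

lemma tensor_ell2_simps [simp]:
  "f \<otimes>\<^sub>2 (g + h) = f \<otimes>\<^sub>2 g + f \<otimes>\<^sub>2 h" "(f' + h') \<otimes>\<^sub>2 g = f' \<otimes>\<^sub>2 g + h' \<otimes>\<^sub>2 g"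
  "f \<otimes>\<^sub>2 (c *\<^sub>C g) = c *\<^sub>C (f \<otimes>\<^sub>2 g)" "(c *\<^sub>C f) \<otimes>\<^sub>2 g = c *\<^sub>C (f \<otimes>\<^sub>2 g)"
  "f \<otimes>\<^sub>2 0 = 0" "0 \<otimes>\<^sub>2 g = 0"
  by (auto intro!: ell2_eqI simp: tensor_ell2.rep_eq plus_ell2.rep_eq scaleC.rep_eq zero_ell2.rep_eq
      algebra_simps)

text \<open>Fubini: the integrand over pairs is summable as the integrand of an inner product, so
  the sum may be taken over one coordinate at a time and then splits.\<close>

lemma cinner_tensor: "cinner (f \<otimes>\<^sub>2 g) (f' \<otimes>\<^sub>2 g') = cinner f f' * cinner g g'"
proof -
  have "cinner (f \<otimes>\<^sub>2 g) (f' \<otimes>\<^sub>2 g') =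
      (\<Sum>\<^sub>\<infinity>x. \<Sum>\<^sub>\<infinity>y. cnj (ell2_fun (f \<otimes>\<^sub>2 g) (x, y)) * ell2_fun (f' \<otimes>\<^sub>2 g') (x, y))"
    using infsum_Sigma_banach[OF cinner_summable[of "f \<otimes>\<^sub>2 g" "f' \<otimes>\<^sub>2 g'" "Sigma UNIV (\<lambda>_. UNIV)"]]
    by (simp add: cinner.rep_eq)
  also have "\<dots> = (\<Sum>\<^sub>\<infinity>x. (\<Sum>\<^sub>\<infinity>y. (cnj (ell2_fun f x) * ell2_fun f' x) * (cnj (ell2_fun g y) * ell2_fun g' y)))"
    by (simp add: tensor_ell2.rep_eq ac_simps)
  finally show ?thesis by (simp add: infsum_cmult_right' infsum_cmult_left' cinner.rep_eq)
qed

lemma norm_tensor: "norm (f \<otimes>\<^sub>2 g) = norm f * norm g"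
proof -
  have "complex_of_real ((norm (f \<otimes>\<^sub>2 g))\<^sup>2) = complex_of_real ((norm f * norm g)\<^sup>2)"
    unfolding cinner_self[symmetric] cinner_tensor by (simp add: cinner_self power_mult_distrib)
  then show ?thesis unfolding of_real_eq_iff by simp
qed

lemma norm_ket [simp]: "norm (ket x) = 1"
proof -
  have "complex_of_real ((norm (ket x))\<^sup>2) = complex_of_real 1"
    unfolding cinner_self[symmetric] by (simp add: cinner_ket ket.rep_eq)
  then show ?thesis unfolding of_real_eq_iff
    using norm_ge_zero[of "ket x"] by (auto simp: power2_eq_1_iff simp del: norm_ge_zero)
qed

lemma cinner_ket_ket: "cinner (ket x) (ket y) = of_bool (x = y)"
  by (auto simp: cinner_ket ket.rep_eq)

lemma bounded_op_tensor_left: "bounded_op (\<lambda>g. f \<otimes>\<^sub>2 g)"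
  by (rule bounded_opI[where K = "norm f"]) (auto simp: norm_tensor)

lemma bounded_op_tensor_right: "bounded_op (\<lambda>f. f \<otimes>\<^sub>2 g)"
  by (rule bounded_opI[where K = "norm g"]) (auto simp: norm_tensor)

section \<open>Bounded operators and adjoints\<close>

lemma bounded_op_id [simp]: "bounded_op id"
  by (rule bounded_opI[where K = 1]) auto

lemma bounded_op_scaleC: "bounded_op T \<Longrightarrow> bounded_op (\<lambda>f. c *\<^sub>C T f)"
proof -
  assume T: "bounded_op T"
  then obtain K where "K \<ge> 0" "\<And>f. norm (T f) \<le> K * norm f" using bounded_op_bound by blast
  with T show ?thesis
    by (intro bounded_opI[where K = "cmod c * K"])
       (simp_all add: bounded_op_simps scaleC_add scaleC_scaleC norm_scaleC mult.assoc mult_left_mono,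
        simp add: mult.commute)
qed

lemma bounded_op_add: "bounded_op S \<Longrightarrow> bounded_op T \<Longrightarrow> bounded_op (\<lambda>f. S f + T f)"
  unfolding bounded_op_def by (auto intro: bounded_linear_add simp: scaleC_add)

lemma cinner_adj_right: "bounded_op T \<Longrightarrow> cinner f (adj T g) = cinner (T f) g"
  by (metis adj(2) cinner_commute)

lemma adj_eqI:
  assumes "bounded_op T" "bounded_op T'" "\<And>f g. cinner (T' f) g = cinner f (T g)"
  shows "adj T = T'"
  using adj_unique_exists[OF assms(1)] adj[OF assms(1)] assms(2,3) by blast

lemma adj_adj: "bounded_op T \<Longrightarrow> adj (adj T) = T"
  by (intro adj_eqI adj) (auto simp: cinner_adj_right)

lemma adj_comp: "bounded_op S \<Longrightarrow> bounded_op T \<Longrightarrow> adj (S \<circ> T) = adj T \<circ> adj S"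
  by (intro adj_eqI) (auto intro: bounded_op_comp adj simp: adj(2))

section \<open>Tensor products of operators, compared on product basis vectors\<close>

lemma bounded_op_tensor_eqI:
  assumes "bounded_op S" "bounded_op T"
    and "\<And>x y. S (ket x \<otimes>\<^sub>2 ket y) = T (ket x \<otimes>\<^sub>2 ket y)"
  shows "S = T"
  using assms by (intro bounded_op_eqI) (auto simp: ket_Pair)

lemma tensor_op_comp:
  assumes "bounded_op a" "bounded_op b" "bounded_op c" "bounded_op d"
  shows "(a \<otimes>\<^sub>o b) \<circ> (c \<otimes>\<^sub>o d) = (a \<circ> c) \<otimes>\<^sub>o (b \<circ> d)"
  using assms by (intro bounded_op_tensor_eqI) (auto simp: tensor_op bounded_op_comp)

lemma tensor_op_id: "id \<otimes>\<^sub>o id = id"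
  by (intro bounded_op_tensor_eqI) (auto simp: tensor_op)

lemma tensor_op_add_left:
  assumes "bounded_op a" "bounded_op b" "bounded_op c"
  shows "(\<lambda>f. a f + b f) \<otimes>\<^sub>o c = (\<lambda>f. (a \<otimes>\<^sub>o c) f + (b \<otimes>\<^sub>o c) f)"
  using assms by (intro bounded_op_tensor_eqI) (auto simp: tensor_op bounded_op_add)

lemma tensor_op_add_right:
  assumes "bounded_op a" "bounded_op b" "bounded_op c"
  shows "c \<otimes>\<^sub>o (\<lambda>f. a f + b f) = (\<lambda>f. (c \<otimes>\<^sub>o a) f + (c \<otimes>\<^sub>o b) f)"
  using assms by (intro bounded_op_tensor_eqI) (auto simp: tensor_op bounded_op_add)

lemma tensor_op_scaleC_left:
  assumes "bounded_op a" "bounded_op c"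
  shows "(\<lambda>f. k *\<^sub>C a f) \<otimes>\<^sub>o c = (\<lambda>f. k *\<^sub>C (a \<otimes>\<^sub>o c) f)"
  using assms by (intro bounded_op_tensor_eqI) (auto simp: tensor_op bounded_op_scaleC)

lemma tensor_op_scaleC_right:
  assumes "bounded_op a" "bounded_op c"
  shows "c \<otimes>\<^sub>o (\<lambda>f. k *\<^sub>C a f) = (\<lambda>f. k *\<^sub>C (c \<otimes>\<^sub>o a) f)"
  using assms by (intro bounded_op_tensor_eqI) (auto simp: tensor_op bounded_op_scaleC)

lemma adj_id: "adj id = id"
  by (intro adj_eqI) auto

text \<open>Matrix entries in the product basis factor, so the adjoint can be moved across each
  factor separately.\<close>

lemma adj_tensor_op:
  assumes a: "bounded_op a" and b: "bounded_op b"
  shows "adj (a \<otimes>\<^sub>o b) = adj a \<otimes>\<^sub>o adj b"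
proof (rule bounded_op_tensor_eqI)
  fix x y
  show "adj (a \<otimes>\<^sub>o b) (ket x \<otimes>\<^sub>2 ket y) = (adj a \<otimes>\<^sub>o adj b) (ket x \<otimes>\<^sub>2 ket y)"
  proof (rule ell2_eqI)
    fix z :: "'a \<times> 'b"
    obtain x' y' where "z = (x', y')" by (cases z)
    then show "ell2_fun (adj (a \<otimes>\<^sub>o b) (ket x \<otimes>\<^sub>2 ket y)) z =
        ell2_fun ((adj a \<otimes>\<^sub>o adj b) (ket x \<otimes>\<^sub>2 ket y)) z"
      using assms
      by (simp add: cinner_ket[symmetric] ket_Pair cinner_adj_right tensor_op adj cinner_tensor)
  qed
qed (use assms in \<open>auto intro: adj tensor_op\<close>)

subsection \<open>Commutants\<close>

lemma commutant_bounded: "T \<in> commutant M \<Longrightarrow> bounded_op T"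
  by (simp add: commutant_def)

lemma commutantD: "T \<in> commutant M \<Longrightarrow> S \<in> M \<Longrightarrow> T \<circ> S = S \<circ> T"
  by (simp add: commutant_def)

lemma commutant_id: "id \<in> commutant M"
  by (simp add: commutant_def)

lemma commutant_comp:
  assumes "S \<in> commutant M" "T \<in> commutant M"
  shows "S \<circ> T \<in> commutant M"
  unfolding commutant_def
proof (intro CollectI conjI ballI bounded_op_comp)
  fix R assume "R \<in> M"
  then show "S \<circ> T \<circ> R = R \<circ> (S \<circ> T)"
    using commutantD[OF assms(1)] commutantD[OF assms(2)] by (simp add: fun_eq_iff)
qed (use assms in \<open>auto simp: commutant_bounded\<close>)

lemma commutant_add:
  assumes M: "\<And>S. S \<in> M \<Longrightarrow> bounded_op S" and "S \<in> commutant M" "T \<in> commutant M"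
  shows "(\<lambda>f. S f + T f) \<in> commutant M"
  unfolding commutant_def
proof (intro CollectI conjI ballI bounded_op_add)
  fix R assume "R \<in> M"
  with assms show "(\<lambda>f. S f + T f) \<circ> R = R \<circ> (\<lambda>f. S f + T f)"
    using commutantD[of S M R] commutantD[of T M R] by (auto simp: fun_eq_iff bounded_op_simps)
qed (use assms in \<open>auto simp: commutant_bounded\<close>)

lemma commutant_scaleC:
  assumes M: "\<And>S. S \<in> M \<Longrightarrow> bounded_op S" and "S \<in> commutant M"
  shows "(\<lambda>f. c *\<^sub>C S f) \<in> commutant M"
  unfolding commutant_def
proof (intro CollectI conjI ballI bounded_op_scaleC)
  fix R assume "R \<in> M"
  with assms show "(\<lambda>f. c *\<^sub>C S f) \<circ> R = R \<circ> (\<lambda>f. c *\<^sub>C S f)"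
    using commutantD[of S M R] by (auto simp: fun_eq_iff bounded_op_simps)
qed (use assms in \<open>auto simp: commutant_bounded\<close>)

lemma commutant_adj:
  assumes M: "\<And>S. S \<in> M \<Longrightarrow> bounded_op S" "\<And>S. S \<in> M \<Longrightarrow> adj S \<in> M"
    and T: "T \<in> commutant M"
  shows "adj T \<in> commutant M"
  unfolding commutant_def
proof (intro CollectI conjI ballI)
  fix S assume S: "S \<in> M"
  \<comment> \<open>\<open>adj S\<close> lies in M as well; taking adjoints of its commutation with
    T gives commutation of \<open>adj T\<close> with S.\<close>
  have "adj (T \<circ> adj S) = adj (adj S \<circ> T)"
    using commutantD[OF T M(2)[OF S]] by simp
  then show "adj T \<circ> S = S \<circ> adj T"
    using S M T by (simp add: adj_comp adj adj_adj commutant_bounded)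
qed (use T in \<open>auto intro: adj commutant_bounded\<close>)

lemma double_commutant_superset: "S \<in> M \<Longrightarrow> bounded_op S \<Longrightarrow> S \<in> commutant (commutant M)"
  by (auto simp: commutant_def)

text \<open>
  With \<open>J i f = f \<otimes> |i\<rangle>\<close> or \<open>J i f = |i\<rangle> \<otimes> f\<close> this lifts a double commutant to one tensor factor:
  the matrix coefficients \<open>J\<^sub>i\<^sup>* T J\<^sub>j\<close> of an operator \<open>T\<close> commuting with every \<open>E m\<close> lie in the
  commutant of \<open>M\<close>, hence commute with \<open>a\<close>.
\<close>

lemma ampliation_commutes:
  fixes J :: "'i \<Rightarrow> 'a ell2 \<Rightarrow> 'c ell2" and E :: "'a op \<Rightarrow> 'c op"
  assumes J: "\<And>i. bounded_op (J i)" "\<And>i j f g. cinner (J i f) (J j g) = of_bool (i = j) * cinner f g"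
    and ket: "\<And>z. \<exists>i x. ket z = J i (ket x)"
    and E: "\<And>b. bounded_op b \<Longrightarrow> bounded_op (E b)" "\<And>b i f. bounded_op b \<Longrightarrow> E b (J i f) = J i (b f)"
    and M: "\<And>m. m \<in> M \<Longrightarrow> bounded_op m"
    and T: "bounded_op T" "\<And>m. m \<in> M \<Longrightarrow> T \<circ> E m = E m \<circ> T"
    and a: "a \<in> commutant (commutant M)"
  shows "T \<circ> E a = E a \<circ> T"
proof -
  have JJ: "adj (J i) (J j f) = of_bool (i = j) *\<^sub>C f" for i j f
    by (rule cinner_eqI) (simp add: cinner_adj_right J cinner_scaleC_right)
  \<comment> \<open>\<open>E b\<close> repeats \<open>b\<close> on the range of every
    \<open>J i\<close>. These ranges are mutually orthogonal and contain all basis vectors, so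
    compressing by \<open>adj (J i)\<close> turns \<open>E b\<close> into \<open>b\<close>.\<close>
  have JE: "adj (J i) \<circ> E b = b \<circ> adj (J i)" if b: "bounded_op b" for i b
  proof (rule bounded_op_eqI)
    fix z
    obtain j x where z: "ket z = J j (ket x)" using ket by blast
    show "(adj (J i) \<circ> E b) (ket z) = (b \<circ> adj (J i)) (ket z)"
      using b by (simp add: z E JJ bounded_op_simps)
  qed (auto intro!: bounded_op_comp adj J E b)
  have ba: "bounded_op a" using a by (rule commutant_bounded)
  have coeff: "adj (J i) \<circ> T \<circ> J j \<in> commutant M" for i j
    unfolding commutant_def
  proof (intro CollectI conjI ballI)
    fix m assume m: "m \<in> M"
    have "(adj (J i) \<circ> T \<circ> J j) (m f) = m ((adj (J i) \<circ> T \<circ> J j) f)" for f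
    proof -
      have "adj (J i) (T (J j (m f))) = adj (J i) (T (E m (J j f)))"
        using M[OF m] by (simp add: E)
      also have "\<dots> = adj (J i) (E m (T (J j f)))"
        using T(2)[OF m] by (metis comp_apply)
      also have "\<dots> = m (adj (J i) (T (J j f)))"
        using JE[OF M[OF m]] by (metis comp_apply)
      finally show ?thesis by simp
    qed
    then show "adj (J i) \<circ> T \<circ> J j \<circ> m = m \<circ> (adj (J i) \<circ> T \<circ> J j)" by auto
  qed (intro bounded_op_comp adj J T)
  show ?thesis
  proof (rule bounded_op_eqI)
    fix z
    obtain j x where z: "ket z = J j (ket x)" using ket by blast
    show "(T \<circ> E a) (ket z) = (E a \<circ> T) (ket z)"
    proof (rule ell2_eqI)
      fix z'
      obtain i x' where z': "ket z' = J i (ket x')" using ket by blast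
      have "adj (J i) (T (E a (J j (ket x)))) = (adj (J i) \<circ> T \<circ> J j) (a (ket x))"
        using ba by (simp add: E)
      also have "\<dots> = a ((adj (J i) \<circ> T \<circ> J j) (ket x))"
        using commutantD[OF a coeff] by (metis comp_apply)
      also have "\<dots> = adj (J i) (E a (T (J j (ket x))))"
        using JE[OF ba] by (simp add: fun_eq_iff)
      finally have "cinner (J i (ket x')) (T (E a (ket z))) = cinner (J i (ket x')) (E a (T (ket z)))"
        by (simp add: z cinner_adj_right[OF J(1), symmetric])
      then show "ell2_fun ((T \<circ> E a) (ket z)) z' = ell2_fun ((E a \<circ> T) (ket z)) z'"
        by (simp add: z'[symmetric] cinner_ket)
    qed
  qed (auto intro: bounded_op_comp T E ba)
qed

subsection \<open>The von Neumann algebra of a groupoid\<close>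

text \<open>The partial isometries \<lambda>(\<alpha>) of single transitions, which serve as
  generators of \<open>\<V> G\<close> in place of the whole algebra of transitions.\<close>

definition transition_op :: "('g, 'x) groupoid \<Rightarrow> 'g \<Rightarrow> 'g op" where
  "transition_op G \<alpha> = left_regular G (transition \<alpha>)"

lemma transition_in_algebra: "transition \<alpha> \<in> transition_algebra G"
  by (simp add: transition_algebra_def transition_def)

context
  fixes G :: "('g, 'x) groupoid"
  assumes G: "is_groupoid G"
begin

section \<open>Cancellation in a groupoid\<close>

lemma groupoid_simps:
  "src G (gunit G x) = x" "tgt G (gunit G x) = x"
  "gcomp G \<alpha> (gunit G (src G \<alpha>)) = \<alpha>" "gcomp G (gunit G (tgt G \<alpha>)) \<alpha> = \<alpha>"
  "src G (ginv G \<alpha>) = tgt G \<alpha>" "tgt G (ginv G \<alpha>) = src G \<alpha>"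
  "src G \<alpha> = tgt G \<beta> \<Longrightarrow> src G (gcomp G \<alpha> \<beta>) = src G \<beta>"
  "src G \<alpha> = tgt G \<beta> \<Longrightarrow> tgt G (gcomp G \<alpha> \<beta>) = tgt G \<alpha>"
  "gcomp G (ginv G \<alpha>) \<alpha> = gunit G (src G \<alpha>)" "gcomp G \<alpha> (ginv G \<alpha>) = gunit G (tgt G \<alpha>)"
  using G by (auto simp: is_groupoid_def)

lemma gcomp_assoc:
  "src G \<alpha> = tgt G \<beta> \<Longrightarrow> src G \<beta> = tgt G \<gamma> \<Longrightarrow>
    gcomp G (gcomp G \<alpha> \<beta>) \<gamma> = gcomp G \<alpha> (gcomp G \<beta> \<gamma>)"
  using G unfolding is_groupoid_def by blast

lemma gcomp_ginv_left: "tgt G \<beta> = src G \<alpha> \<Longrightarrow> gcomp G (ginv G \<alpha>) (gcomp G \<alpha> \<beta>) = \<beta>"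
  using gcomp_assoc[of "ginv G \<alpha>" \<alpha> \<beta>] by (metis groupoid_simps(4,5,9))

lemma gcomp_ginv_right: "tgt G \<beta> = tgt G \<alpha> \<Longrightarrow> gcomp G \<alpha> (gcomp G (ginv G \<alpha>) \<beta>) = \<beta>"
  using gcomp_assoc[of \<alpha> "ginv G \<alpha>" \<beta>] by (metis groupoid_simps(4,5,6,10))

text \<open>Composability is carried along on both sides because \<open>gcomp\<close> is total.
  Solving for \<beta> in this way turns the coefficient formula of \<lambda>(\<alpha>) into its
  action on basis vectors and identifies its adjoint.\<close>

lemma gcomp_eq_iff:
  "src G \<alpha> = tgt G \<beta> \<and> gcomp G \<alpha> \<beta> = \<gamma> \<longleftrightarrow> tgt G \<alpha> = tgt G \<gamma> \<and> gcomp G (ginv G \<alpha>) \<gamma> = \<beta>"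
  (is "?L \<longleftrightarrow> ?R")
proof
  assume L: ?L
  then show ?R
    using gcomp_ginv_left[of \<beta> \<alpha>] groupoid_simps(8)[of \<alpha> \<beta>] by metis
next
  assume R: ?R
  then show ?L
    using gcomp_ginv_right[of \<gamma> \<alpha>] groupoid_simps(8)[of "ginv G \<alpha>" \<gamma>] groupoid_simps(5,6)[of \<alpha>] by metis
qed

section \<open>Transitions as operators\<close>

lemma ell2_fun_transition_op:
  "ell2_fun (transition_op G \<alpha> \<Psi>) \<beta> =
    (if tgt G \<alpha> = tgt G \<beta> then ell2_fun \<Psi> (gcomp G (ginv G \<alpha>) \<beta>) else 0)"
proof -
  have "{\<gamma>. transition \<alpha> \<gamma> \<noteq> 0 \<and> tgt G \<gamma> = tgt G \<beta>} = (if tgt G \<alpha> = tgt G \<beta> then {\<alpha>} else {})"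
    by (auto simp: transition_def)
  then show ?thesis
    by (simp add: transition_op_def ell2_fun_left_regular[OF G transition_in_algebra]) (simp add: transition_def)
qed

text \<open>Left translation by the inverse of \<alpha> is injective on the transitions that share
  the target of \<alpha>, and all other coordinates of the image vanish; hence a
  contraction.\<close>

lemma bounded_transition_op: "bounded_op (transition_op G \<alpha>)"
proof (rule bounded_opI[where K = 1])
  fix \<Psi>
  show "norm (transition_op G \<alpha> \<Psi>) \<le> 1 * norm \<Psi>"
  proof (rule ell2_norm_le)
    fix F :: "'g set" assume F: "finite F"
    let ?F = "{\<beta>\<in>F. tgt G \<alpha> = tgt G \<beta>}"
    have inj: "inj_on (gcomp G (ginv G \<alpha>)) ?F"
      by (rule inj_on_inverseI[where g = "gcomp G \<alpha>"]) (simp add: gcomp_ginv_right)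
    have "(\<Sum>\<beta>\<in>F. (cmod (ell2_fun (transition_op G \<alpha> \<Psi>) \<beta>))\<^sup>2) =
        (\<Sum>\<beta>\<in>?F. (cmod (ell2_fun \<Psi> (gcomp G (ginv G \<alpha>) \<beta>)))\<^sup>2)"
      using F by (intro sum.mono_neutral_cong_right) (auto simp: ell2_fun_transition_op)
    also have "\<dots> = (\<Sum>\<beta>\<in>gcomp G (ginv G \<alpha>) ` ?F. (cmod (ell2_fun \<Psi> \<beta>))\<^sup>2)"
      by (simp add: sum.reindex[OF inj])
    also have "\<dots> \<le> (norm \<Psi>)\<^sup>2" using F by (intro sum_le_norm_ell2) auto
    finally show "(\<Sum>\<beta>\<in>F. (cmod (ell2_fun (transition_op G \<alpha> \<Psi>) \<beta>))\<^sup>2) \<le> (1 * norm \<Psi>)\<^sup>2" by simp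
  qed simp
qed (auto intro!: ell2_eqI simp: ell2_fun_transition_op plus_ell2.rep_eq scaleC.rep_eq)

lemma transition_op_ket:
  "transition_op G \<alpha> (ket \<gamma>) = (if src G \<alpha> = tgt G \<gamma> then ket (gcomp G \<alpha> \<gamma>) else 0)"
proof (rule ell2_eqI)
  fix \<beta>
  show "ell2_fun (transition_op G \<alpha> (ket \<gamma>)) \<beta> =
      ell2_fun (if src G \<alpha> = tgt G \<gamma> then ket (gcomp G \<alpha> \<gamma>) else 0) \<beta>"
    using gcomp_eq_iff[of \<alpha> \<gamma> \<beta>] by (auto simp: ell2_fun_transition_op ket.rep_eq zero_ell2.rep_eq)
qed

lemma transition_op_comp:
  "transition_op G \<alpha> \<circ> transition_op G \<beta> =
    (if src G \<alpha> = tgt G \<beta> then transition_op G (gcomp G \<alpha> \<beta>) else (\<lambda>_. 0))"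
proof (rule bounded_op_eqI)
  fix \<gamma>
  show "(transition_op G \<alpha> \<circ> transition_op G \<beta>) (ket \<gamma>) =
      (if src G \<alpha> = tgt G \<beta> then transition_op G (gcomp G \<alpha> \<beta>) else (\<lambda>_. 0)) (ket \<gamma>)"
  proof (cases "src G \<beta> = tgt G \<gamma>")
    case True
    then show ?thesis
      using gcomp_assoc[of \<alpha> \<beta> \<gamma>] groupoid_simps(7)[of \<alpha> \<beta>] groupoid_simps(8)[of \<beta> \<gamma>]
      by (auto simp: transition_op_ket)
  next
    \<comment> \<open>Both sides annihilate \<open>ket \<gamma>\<close>: a composite of \<alpha> and
      \<beta> has the source of \<beta>, so it does not meet the target of \<gamma> either.\<close>
    case False
    then show ?thesis
      using groupoid_simps(7)[of \<alpha> \<beta>]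
      by (auto simp: transition_op_ket bounded_op_simps(3)[OF bounded_transition_op])
  qed
qed (auto intro!: bounded_op_comp bounded_transition_op bounded_opI[of "\<lambda>_. 0" 0])

lemma adj_transition_op: "adj (transition_op G \<alpha>) = transition_op G (ginv G \<alpha>)"
proof (rule bounded_op_eqI)
  fix \<gamma>
  show "adj (transition_op G \<alpha>) (ket \<gamma>) = transition_op G (ginv G \<alpha>) (ket \<gamma>)"
  proof (rule ell2_eqI)
    fix \<beta>
    show "ell2_fun (adj (transition_op G \<alpha>) (ket \<gamma>)) \<beta> =
        ell2_fun (transition_op G (ginv G \<alpha>) (ket \<gamma>)) \<beta>"
    proof -
      have "ell2_fun (adj (transition_op G \<alpha>) (ket \<gamma>)) \<beta> = cinner (transition_op G \<alpha> (ket \<beta>)) (ket \<gamma>)"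
        by (simp only: cinner_ket[symmetric] cinner_adj_right[OF bounded_transition_op])
      also have "\<dots> = of_bool (src G \<alpha> = tgt G \<beta> \<and> gcomp G \<alpha> \<beta> = \<gamma>)"
        by (simp add: transition_op_ket cinner_ket_ket)
      also have "\<dots> = of_bool (tgt G \<alpha> = tgt G \<gamma> \<and> gcomp G (ginv G \<alpha>) \<gamma> = \<beta>)"
        by (simp only: gcomp_eq_iff)
      also have "\<dots> = ell2_fun (transition_op G (ginv G \<alpha>) (ket \<gamma>)) \<beta>"
        by (simp add: transition_op_ket groupoid_simps(5) ket.rep_eq zero_ell2.rep_eq)
      finally show ?thesis .
    qed
  qed
qed (intro adj bounded_transition_op)+

section \<open>Generators and closure properties of the von Neumann algebra\<close>

lemma left_regular_eq_sum:
  assumes "A \<in> transition_algebra G"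
  shows "left_regular G A \<Psi> = (\<Sum>\<alpha> | A \<alpha> \<noteq> 0. A \<alpha> *\<^sub>C transition_op G \<alpha> \<Psi>)"
proof (rule ell2_eqI)
  fix \<beta>
  have "finite {\<alpha>. A \<alpha> \<noteq> 0}" using assms by (simp add: transition_algebra_def)
  then show "ell2_fun (left_regular G A \<Psi>) \<beta> =
      ell2_fun (\<Sum>\<alpha> | A \<alpha> \<noteq> 0. A \<alpha> *\<^sub>C transition_op G \<alpha> \<Psi>) \<beta>"
    unfolding ell2_fun_left_regular[OF G assms] ell2_fun_sum scaleC.rep_eq ell2_fun_transition_op
    by (intro sum.mono_neutral_cong_left) auto
qed

text \<open>Commuting with each \<open>transition_op\<close> passes to finite linear combinations,
  so the first commutants already coincide.\<close>

lemma vN_algebra_eq: "\<V> G = commutant (commutant (range (transition_op G)))"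
proof -
  have "T \<circ> left_regular G A = left_regular G A \<circ> T"
    if T: "T \<in> commutant (range (transition_op G))" and A: "A \<in> transition_algebra G" for T A
  proof
    fix \<Psi>
    have "T (transition_op G \<alpha> \<Psi>) = transition_op G \<alpha> (T \<Psi>)" for \<alpha>
      using commutantD[OF T, of "transition_op G \<alpha>"] by (auto simp: fun_eq_iff)
    then show "(T \<circ> left_regular G A) \<Psi> = (left_regular G A \<circ> T) \<Psi>"
      using commutant_bounded[OF T] by (simp add: left_regular_eq_sum[OF A] bounded_op_simps)
  qed
  moreover have "range (transition_op G) \<subseteq> left_regular G ` transition_algebra G"
    by (auto simp: transition_op_def transition_in_algebra)
  ultimately have "commutant (left_regular G ` transition_algebra G) = commutant (range (transition_op G))"
    unfolding commutant_def by blast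
  then show ?thesis by (simp add: vN_algebra_def)
qed

lemma vN_bounded: "a \<in> \<V> G \<Longrightarrow> bounded_op a"
  by (simp add: vN_algebra_def commutant_bounded)

lemma vN_transition_op: "transition_op G \<alpha> \<in> \<V> G"
  by (simp add: vN_algebra_eq double_commutant_superset bounded_transition_op)

lemma vN_id: "id \<in> \<V> G"
  by (simp add: vN_algebra_def commutant_id)

lemma vN_comp: "a \<in> \<V> G \<Longrightarrow> b \<in> \<V> G \<Longrightarrow> a \<circ> b \<in> \<V> G"
  by (simp add: vN_algebra_def commutant_comp)

lemma vN_add: "a \<in> \<V> G \<Longrightarrow> b \<in> \<V> G \<Longrightarrow> (\<lambda>\<Psi>. a \<Psi> + b \<Psi>) \<in> \<V> G"
  unfolding vN_algebra_def by (rule commutant_add) (auto intro: commutant_bounded)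

lemma vN_scaleC: "a \<in> \<V> G \<Longrightarrow> (\<lambda>\<Psi>. c *\<^sub>C a \<Psi>) \<in> \<V> G"
  unfolding vN_algebra_def by (rule commutant_scaleC) (auto intro: commutant_bounded)

text \<open>Closure under adjoints climbs from the generators, where the adjoint is the inverse
  transition, to their commutant and from there to the double commutant.\<close>

lemma vN_adj: "a \<in> \<V> G \<Longrightarrow> adj a \<in> \<V> G"
proof -
  let ?M = "range (transition_op G)"
  assume a: "a \<in> \<V> G"
  have "adj S \<in> commutant ?M" if "S \<in> commutant ?M" for S
    by (rule commutant_adj[OF _ _ that]) (auto simp: bounded_transition_op adj_transition_op)
  with a show "adj a \<in> \<V> G"
    unfolding vN_algebra_eq using commutant_adj[of "commutant ?M" a] commutant_bounded by blast
qed

end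

subsection \<open>Direct products\<close>

lemma is_groupoid_prod: "is_groupoid GA \<Longrightarrow> is_groupoid GB \<Longrightarrow> is_groupoid (GA \<times>\<^sub>G GB)"
  unfolding is_groupoid_def prod_groupoid_def by simp

context
  fixes GA :: "('gA, 'xA) groupoid" and GB :: "('gB, 'xB) groupoid"
  assumes GA: "is_groupoid GA" and GB: "is_groupoid GB"
begin

lemma transition_op_prod:
  "transition_op (GA \<times>\<^sub>G GB) (\<alpha>, \<beta>) = transition_op GA \<alpha> \<otimes>\<^sub>o transition_op GB \<beta>"
proof (rule bounded_op_tensor_eqI)
  fix \<gamma> \<delta>
  have bA: "bounded_op (transition_op GA \<alpha>)" by (rule bounded_transition_op[OF GA])
  have bB: "bounded_op (transition_op GB \<beta>)" by (rule bounded_transition_op[OF GB])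
  show "transition_op (GA \<times>\<^sub>G GB) (\<alpha>, \<beta>) (ket \<gamma> \<otimes>\<^sub>2 ket \<delta>) =
      (transition_op GA \<alpha> \<otimes>\<^sub>o transition_op GB \<beta>) (ket \<gamma> \<otimes>\<^sub>2 ket \<delta>)"
    unfolding tensor_op(2)[OF bA bB]
    unfolding ket_Pair[symmetric] transition_op_ket[OF is_groupoid_prod[OF GA GB]]
      transition_op_ket[OF GA] transition_op_ket[OF GB]
    by (auto simp: prod_groupoid_def ket_Pair)
qed (intro bounded_transition_op is_groupoid_prod tensor_op GA GB)+

text \<open>T is only given to commute with products \<alpha> \<otimes> \<beta>, and with infinitely
  many outcomes \<open>id\<close> is not a finite sum of units. The passage to \<alpha> \<otimes> id
  is made one basis vector at a time, by cutting down with a product of units that fixes the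
  vector.\<close>

lemma commutant_transition_op_prod:
  assumes T: "T \<in> commutant (range (transition_op (GA \<times>\<^sub>G GB)))"
  shows "T \<circ> (transition_op GA \<alpha> \<otimes>\<^sub>o id) = (transition_op GA \<alpha> \<otimes>\<^sub>o id) \<circ> T"
    and "T \<circ> (id \<otimes>\<^sub>o transition_op GB \<beta>) = (id \<otimes>\<^sub>o transition_op GB \<beta>) \<circ> T"
proof -
  note bA = bounded_transition_op[OF GA] and bB = bounded_transition_op[OF GB]
  have bT: "bounded_op T" using T by (rule commutant_bounded)
  have comm: "T ((transition_op GA \<gamma> \<otimes>\<^sub>o transition_op GB \<delta>) f) =
      (transition_op GA \<gamma> \<otimes>\<^sub>o transition_op GB \<delta>) (T f)" for \<gamma> \<delta> f
    using commutantD[OF T, of "transition_op (GA \<times>\<^sub>G GB) (\<gamma>, \<delta>)"]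
    by (auto simp: transition_op_prod[symmetric] fun_eq_iff)
  have main: "T \<circ> R = R \<circ> T" if R: "bounded_op R"
    and Q: "\<And>x y. \<exists>\<gamma> \<delta>. R \<circ> (transition_op GA (gunit GA x) \<otimes>\<^sub>o transition_op GB (gunit GB y)) =
        (transition_op GA \<gamma> \<otimes>\<^sub>o transition_op GB \<delta>) \<circ>
        (transition_op GA (gunit GA x) \<otimes>\<^sub>o transition_op GB (gunit GB y))"
    for R :: "('gA \<times> 'gB) op"
  proof (rule bounded_op_tensor_eqI)
    fix \<gamma> :: 'gA and \<delta> :: 'gB
    let ?k = "ket \<gamma> \<otimes>\<^sub>2 ket \<delta>"
    \<comment> \<open>The units at the targets of \<gamma> and \<delta> fix \<open>?k\<close>. Both
      \<open>P\<close> and \<open>R \<circ> P\<close> are built from product transitions and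
      therefore commute with T.\<close>
    define P where "P = transition_op GA (gunit GA (tgt GA \<gamma>)) \<otimes>\<^sub>o transition_op GB (gunit GB (tgt GB \<delta>))"
    have P: "P ?k = ?k"
      by (simp add: P_def tensor_op bA bB transition_op_ket[OF GA] transition_op_ket[OF GB]
          groupoid_simps[OF GA] groupoid_simps[OF GB])
    obtain \<gamma>' \<delta>' where RP: "R \<circ> P = (transition_op GA \<gamma>' \<otimes>\<^sub>o transition_op GB \<delta>') \<circ> P"
      using Q unfolding P_def by blast
    have "T (R ?k) = T ((R \<circ> P) ?k)" by (simp add: P)
    also have "\<dots> = (R \<circ> P) (T ?k)" by (simp add: RP comm, simp add: P_def comm)
    also have "\<dots> = R (T (P ?k))" by (simp add: P_def comm)
    finally show "(T \<circ> R) ?k = (R \<circ> T) ?k" by (simp add: P)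
  qed (intro bounded_op_comp bT R)+
  \<comment> \<open>Idempotence of units: on the range of \<open>P\<close> the factor
    \<open>id\<close> of \<open>R\<close> acts as a unit, which makes \<open>R\<close> a product of
    transitions there.\<close>
  have uA: "transition_op GA (gunit GA x) \<circ> transition_op GA (gunit GA x) = transition_op GA (gunit GA x)" for x
    using groupoid_simps(1-3)[OF GA] by (metis transition_op_comp[OF GA])
  have uB: "transition_op GB (gunit GB y) \<circ> transition_op GB (gunit GB y) = transition_op GB (gunit GB y)" for y
    using groupoid_simps(1-3)[OF GB] by (metis transition_op_comp[OF GB])
  show "T \<circ> (transition_op GA \<alpha> \<otimes>\<^sub>o id) = (transition_op GA \<alpha> \<otimes>\<^sub>o id) \<circ> T"
  proof (rule main)
    fix x y
    show "\<exists>\<gamma> \<delta>. (transition_op GA \<alpha> \<otimes>\<^sub>o id) \<circ> (transition_op GA (gunit GA x) \<otimes>\<^sub>o transition_op GB (gunit GB y)) =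
        (transition_op GA \<gamma> \<otimes>\<^sub>o transition_op GB \<delta>) \<circ>
        (transition_op GA (gunit GA x) \<otimes>\<^sub>o transition_op GB (gunit GB y))"
      by (intro exI[of _ \<alpha>] exI[of _ "gunit GB y"]) (simp add: tensor_op_comp bA bB uB)
  qed (simp add: tensor_op bA)
  show "T \<circ> (id \<otimes>\<^sub>o transition_op GB \<beta>) = (id \<otimes>\<^sub>o transition_op GB \<beta>) \<circ> T"
  proof (rule main)
    fix x y
    show "\<exists>\<gamma> \<delta>. (id \<otimes>\<^sub>o transition_op GB \<beta>) \<circ> (transition_op GA (gunit GA x) \<otimes>\<^sub>o transition_op GB (gunit GB y)) =
        (transition_op GA \<gamma> \<otimes>\<^sub>o transition_op GB \<delta>) \<circ>
        (transition_op GA (gunit GA x) \<otimes>\<^sub>o transition_op GB (gunit GB y))"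
      by (intro exI[of _ "gunit GA x"] exI[of _ \<beta>]) (simp add: tensor_op_comp bA bB uA)
  qed (simp add: tensor_op bB)
qed

text \<open>An operator commuting with the product transitions commutes with every \<alpha>
  \<otimes> id; \<open>ampliation_commutes\<close>, with the slices over the basis of the second
  factor as J, extends this to the double commutant.\<close>

lemma vN_tensor_id_right:
  assumes a: "a \<in> \<V> GA"
  shows "a \<otimes>\<^sub>o id \<in> \<V> (GA \<times>\<^sub>G GB)"
proof -
  have ba: "bounded_op a" using GA a by (rule vN_bounded)
  have "T \<circ> (a \<otimes>\<^sub>o id) = (a \<otimes>\<^sub>o id) \<circ> T" if T: "T \<in> commutant (range (transition_op (GA \<times>\<^sub>G GB)))" for T
  proof (rule ampliation_commutes[where J = "\<lambda>y f. f \<otimes>\<^sub>2 ket y" and E = "\<lambda>b. b \<otimes>\<^sub>o id"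
        and M = "range (transition_op GA)"])
    fix z :: "'gA \<times> 'gB"
    show "\<exists>y x. ket z = ket x \<otimes>\<^sub>2 ket y" by (metis ket_Pair surj_pair)
  qed (use a T in \<open>auto simp: vN_algebra_eq[OF GA] cinner_tensor cinner_ket_ket tensor_op
        bounded_op_tensor_right bounded_transition_op[OF GA] commutant_bounded commutant_transition_op_prod\<close>)
  then show ?thesis
    using ba by (simp add: vN_algebra_eq[OF is_groupoid_prod[OF GA GB]] commutant_def[of "commutant _"] tensor_op)
qed

lemma vN_tensor_id_left:
  assumes b: "b \<in> \<V> GB"
  shows "id \<otimes>\<^sub>o b \<in> \<V> (GA \<times>\<^sub>G GB)"
proof -
  have bb: "bounded_op b" using GB b by (rule vN_bounded)
  have "T \<circ> (id \<otimes>\<^sub>o b) = (id \<otimes>\<^sub>o b) \<circ> T" if T: "T \<in> commutant (range (transition_op (GA \<times>\<^sub>G GB)))" for T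
  proof (rule ampliation_commutes[where J = "\<lambda>x f. ket x \<otimes>\<^sub>2 f" and E = "\<lambda>b. id \<otimes>\<^sub>o b"
        and M = "range (transition_op GB)"])
    fix z :: "'gA \<times> 'gB"
    show "\<exists>x y. ket z = ket x \<otimes>\<^sub>2 ket y" by (metis ket_Pair surj_pair)
  qed (use b T in \<open>auto simp: vN_algebra_eq[OF GB] cinner_tensor cinner_ket_ket tensor_op
        bounded_op_tensor_left bounded_transition_op[OF GB] commutant_bounded commutant_transition_op_prod\<close>)
  then show ?thesis
    using bb by (simp add: vN_algebra_eq[OF is_groupoid_prod[OF GA GB]] commutant_def[of "commutant _"] tensor_op)
qed

end
subsection \<open>The fundamental representation\<close>

context
  fixes G :: "('g, 'x) groupoid" and \<pi> :: "'g op \<Rightarrow> 'x op"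
  assumes G: "is_groupoid G" and \<pi>: "fundamental_representation G \<pi>"
begin

lemma rep_bounded: "a \<in> \<V> G \<Longrightarrow> bounded_op (\<pi> a)"
  and rep_add: "a \<in> \<V> G \<Longrightarrow> b \<in> \<V> G \<Longrightarrow> \<pi> (\<lambda>\<Psi>. a \<Psi> + b \<Psi>) = (\<lambda>\<Psi>. \<pi> a \<Psi> + \<pi> b \<Psi>)"
  and rep_scaleC: "a \<in> \<V> G \<Longrightarrow> \<pi> (\<lambda>\<Psi>. c *\<^sub>C a \<Psi>) = (\<lambda>\<Psi>. c *\<^sub>C \<pi> a \<Psi>)"
  and rep_comp: "a \<in> \<V> G \<Longrightarrow> b \<in> \<V> G \<Longrightarrow> \<pi> (a \<circ> b) = \<pi> a \<circ> \<pi> b"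
  and rep_adj: "a \<in> \<V> G \<Longrightarrow> \<pi> (adj a) = adj (\<pi> a)"
  using \<pi> unfolding fundamental_representation_def star_representation_def by blast+

text \<open>A transition is represented by the matrix unit from its source to its target;
  boundedness extends the prescribed values from basis vectors to all f.\<close>

lemma rep_transition_op: "\<pi> (transition_op G \<alpha>) f = ell2_fun f (src G \<alpha>) *\<^sub>C ket (tgt G \<alpha>)"
proof -
  have "\<pi> (transition_op G \<alpha>) = (\<lambda>f. cinner (ket (src G \<alpha>)) f *\<^sub>C ket (tgt G \<alpha>))"
  proof (rule bounded_op_eqI)
    show "bounded_op (\<lambda>f. cinner (ket (src G \<alpha>)) f *\<^sub>C ket (tgt G \<alpha>))"
      using cinner_Cauchy_Schwarz[of "ket (src G \<alpha>)"]
      by (intro bounded_opI[where K = 1])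
         (auto simp: cinner_add_right scaleC_add_left cinner_scaleC_right scaleC_scaleC norm_scaleC)
    show "\<pi> (transition_op G \<alpha>) (ket x) = cinner (ket (src G \<alpha>)) (ket x) *\<^sub>C ket (tgt G \<alpha>)" for x
      using \<pi> by (auto simp: fundamental_representation_def transition_op_def cinner_ket_ket)
  qed (intro rep_bounded vN_transition_op G)
  then show ?thesis by (simp add: cinner_ket)
qed

text \<open>\<open>star_representation\<close> does not postulate this. Each \<open>ket x\<close> is
  fixed by the image of the unit at x, and by multiplicativity \<open>\<pi> id\<close> is neutral on
  the range of that image.\<close>

lemma rep_id: "\<pi> id = id"
proof (rule bounded_op_eqI)
  fix x
  let ?E = "transition_op G (gunit G x)"
  have E: "\<pi> ?E (ket x) = ket x"
    by (simp add: rep_transition_op groupoid_simps[OF G] ket.rep_eq)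
  have "\<pi> id (\<pi> ?E (ket x)) = \<pi> (id \<circ> ?E) (ket x)"
    by (simp only: rep_comp[OF vN_id[OF G] vN_transition_op[OF G]] comp_apply)
  with E show "\<pi> id (ket x) = id (ket x)" by simp
qed (intro rep_bounded vN_id G bounded_op_id)+

lemma rep_zero: "\<pi> (\<lambda>_. 0) = (\<lambda>_. 0)"
  using rep_scaleC[OF vN_id[OF G], of 0] by simp

text \<open>The units at z and w are represented by the projections onto \<open>ket z\<close> and
  \<open>ket w\<close>, so compressing \<open>a\<close> by them inside the algebra isolates this
  matrix entry of \<open>\<pi> a\<close>.\<close>

lemma rep_matrix_entry_eq_0:
  assumes a: "a \<in> \<V> G"
    and 0: "\<And>\<Psi>. transition_op G (gunit G z) (a (transition_op G (gunit G w) \<Psi>)) = 0"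
  shows "ell2_fun (\<pi> a (ket w)) z = 0"
proof -
  let ?E = "\<lambda>x. transition_op G (gunit G x)"
  have "ell2_fun (\<pi> a (ket w)) z *\<^sub>C ket z = (\<pi> (?E z) \<circ> (\<pi> a \<circ> \<pi> (?E w))) (ket w)"
    by (simp add: rep_transition_op groupoid_simps[OF G] ket.rep_eq)
  also have "\<dots> = \<pi> (?E z \<circ> (a \<circ> ?E w)) (ket w)"
    using a by (simp add: rep_comp vN_comp vN_transition_op G)
  also have "?E z \<circ> (a \<circ> ?E w) = (\<lambda>_. 0)" using 0 by auto
  finally have "ell2_fun (ell2_fun (\<pi> a (ket w)) z *\<^sub>C ket z) z = 0" by (simp add: rep_zero zero_ell2.rep_eq)
  then show ?thesis by (simp add: scaleC.rep_eq ket.rep_eq)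
qed

lemma state_vector_functional:
  assumes "norm v = 1"
  shows "state (\<V> G) (vector_functional \<pi> v)"
  unfolding state_def vector_functional_def
proof (intro conjI ballI allI)
  fix a b c assume a: "a \<in> \<V> G"
  show "cinner v (\<pi> (\<lambda>\<Psi>. a \<Psi> + b \<Psi>) v) = cinner v (\<pi> a v) + cinner v (\<pi> b v)" if "b \<in> \<V> G"
    using a that by (simp add: rep_add cinner_add_right)
  show "cinner v (\<pi> (\<lambda>\<Psi>. c *\<^sub>C a \<Psi>) v) = c * cinner v (\<pi> a v)"
    using a by (simp add: rep_scaleC cinner_scaleC_right)
  have "cinner v (\<pi> (adj a \<circ> a) v) = cinner (\<pi> a v) (\<pi> a v)"
    using a by (simp add: rep_comp rep_adj vN_adj[OF G] cinner_adj_right rep_bounded)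
  then show "cinner v (\<pi> (adj a \<circ> a) v) \<in> \<real>\<^sub>\<ge>\<^sub>0" by (simp add: cinner_self)
next
  show "cinner v (\<pi> id v) = 1" using assms by (simp add: rep_id cinner_self)
qed

end

lemma unitary_group_vN_algebra:
  assumes G: "is_groupoid G" and u: "unitary_group (\<V> G) u"
  shows "u t \<in> \<V> G" "adj (u t) \<in> \<V> G" "u t \<circ> adj (u t) = id"
  using u by (auto simp: unitary_group_def intro: vN_adj[OF G])

subsection \<open>Product states and separable states\<close>

text \<open>The marginal on the first factor, one of the two states that a product state must
  exhibit. Positivity survives because tensoring with \<open>id\<close> respects products and
  adjoints.\<close>

lemma state_tensor_id_right:
  fixes GA :: "('gA, 'xA) groupoid" and GB :: "('gB, 'xB) groupoid"
  assumes GA: "is_groupoid GA" and GB: "is_groupoid GB" and \<sigma>: "state (\<V> (GA \<times>\<^sub>G GB)) \<sigma>"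
  shows "state (\<V> GA) (\<lambda>a. \<sigma> (a \<otimes>\<^sub>o id))"
proof -
  note V = vN_tensor_id_right[OF GA GB] and b = vN_bounded[OF GA]
  have "\<sigma> ((adj a \<circ> a) \<otimes>\<^sub>o id) \<in> \<real>\<^sub>\<ge>\<^sub>0" if a: "a \<in> \<V> GA" for a
  proof -
    have "(adj a \<circ> a) \<otimes>\<^sub>o (id :: 'gB op) = adj (a \<otimes>\<^sub>o id) \<circ> (a \<otimes>\<^sub>o id)"
      using b[OF a] by (simp add: adj_tensor_op tensor_op_comp adj adj_id)
    then show ?thesis using \<sigma> V[OF a] by (simp add: state_def)
  qed
  then show ?thesis
    using \<sigma> V b by (auto simp: state_def tensor_op_add_left tensor_op_scaleC_left tensor_op_id)
qed

lemma state_tensor_id_left: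
  fixes GA :: "('gA, 'xA) groupoid" and GB :: "('gB, 'xB) groupoid"
  assumes GA: "is_groupoid GA" and GB: "is_groupoid GB" and \<sigma>: "state (\<V> (GA \<times>\<^sub>G GB)) \<sigma>"
  shows "state (\<V> GB) (\<lambda>b. \<sigma> (id \<otimes>\<^sub>o b))"
proof -
  note V = vN_tensor_id_left[OF GA GB] and b = vN_bounded[OF GB]
  have "\<sigma> (id \<otimes>\<^sub>o (adj a \<circ> a)) \<in> \<real>\<^sub>\<ge>\<^sub>0" if a: "a \<in> \<V> GB" for a
  proof -
    have "(id :: 'gA op) \<otimes>\<^sub>o (adj a \<circ> a) = adj (id \<otimes>\<^sub>o a) \<circ> (id \<otimes>\<^sub>o a)"
      using b[OF a] by (simp add: adj_tensor_op tensor_op_comp adj adj_id)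
    then show ?thesis using \<sigma> V[OF a] by (simp add: state_def)
  qed
  then show ?thesis
    using \<sigma> V b by (auto simp: state_def tensor_op_add_right tensor_op_scaleC_right tensor_op_id)
qed

lemma has_sum_nonneg_Reals:
  fixes f :: "'i \<Rightarrow> complex"
  assumes f: "(f has_sum s) A" and nn: "\<And>x. x \<in> A \<Longrightarrow> f x \<in> \<real>\<^sub>\<ge>\<^sub>0"
  shows "s \<in> \<real>\<^sub>\<ge>\<^sub>0"
proof -
  have "((\<lambda>x. Re (f x)) has_sum Re s) A" "((\<lambda>x. Im (f x)) has_sum Im s) A"
    using f by (auto intro: has_sum_Re has_sum_Im)
  moreover have "Re (f x) \<ge> 0" "Im (f x) = 0" if "x \<in> A" for x
    using nn[OF that] by (auto simp: complex_nonneg_Reals_iff)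
  ultimately have "Re s \<ge> 0" "Im s = 0"
    by (auto intro: has_sum_nonneg has_sum_unique[OF _ has_sum_0])
  then show ?thesis by (simp add: complex_nonneg_Reals_iff)
qed

text \<open>The properties of a state pass termwise to \<rho> by uniqueness of sums. The index set
  may be any countable set here, whereas \<open>separable_state\<close> wants natural numbers, so
  the mixture is transported along \<open>to_nat_on\<close>.\<close>

lemma separable_stateI:
  fixes GA :: "('gA, 'xA) groupoid" and GB :: "('gB, 'xB) groupoid"
  assumes GA: "is_groupoid GA" and GB: "is_groupoid GB" and I: "countable (I :: 'i set)"
    and p: "\<And>i. i \<in> I \<Longrightarrow> p i \<ge> 0" "(p has_sum (1 :: real)) I"
    and \<sigma>: "\<And>i. i \<in> I \<Longrightarrow> product_state GA GB (\<sigma> i)"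
    and \<rho>: "\<And>a. a \<in> \<V> (GA \<times>\<^sub>G GB) \<Longrightarrow> ((\<lambda>i. complex_of_real (p i) * \<sigma> i a) has_sum \<rho> a) I"
  shows "separable_state GA GB \<rho>"
proof -
  let ?V = "\<V> (GA \<times>\<^sub>G GB)"
  note V = vN_add[OF is_groupoid_prod[OF GA GB]] vN_scaleC[OF is_groupoid_prod[OF GA GB]]
    vN_id[OF is_groupoid_prod[OF GA GB]] vN_comp[OF is_groupoid_prod[OF GA GB]]
    vN_adj[OF is_groupoid_prod[OF GA GB]]
  have st: "state ?V (\<sigma> i)" if "i \<in> I" for i
    using \<sigma>[OF that] by (simp add: product_state_def)
  have "state ?V \<rho>"
    unfolding state_def
  proof (intro conjI ballI allI)
    fix a assume a: "a \<in> ?V"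
    show "\<rho> (\<lambda>\<Psi>. a \<Psi> + b \<Psi>) = \<rho> a + \<rho> b" if b: "b \<in> ?V" for b
    proof -
      have "((\<lambda>i. complex_of_real (p i) * \<sigma> i (\<lambda>\<Psi>. a \<Psi> + b \<Psi>)) has_sum (\<rho> a + \<rho> b)) I
        \<longleftrightarrow> ((\<lambda>i. complex_of_real (p i) * \<sigma> i a + complex_of_real (p i) * \<sigma> i b) has_sum (\<rho> a + \<rho> b)) I"
        using st a b by (intro has_sum_cong) (simp add: state_def algebra_simps)
      then show ?thesis using has_sum_add[OF \<rho>[OF a] \<rho>[OF b]] \<rho>[OF V(1)[OF a b]] has_sum_unique by blast
    qed
    show "\<rho> (\<lambda>\<Psi>. c *\<^sub>C a \<Psi>) = c * \<rho> a" for c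
    proof -
      have "((\<lambda>i. complex_of_real (p i) * \<sigma> i (\<lambda>\<Psi>. c *\<^sub>C a \<Psi>)) has_sum (c * \<rho> a)) I
        \<longleftrightarrow> ((\<lambda>i. c * (complex_of_real (p i) * \<sigma> i a)) has_sum (c * \<rho> a)) I"
        using st a by (intro has_sum_cong) (simp add: state_def algebra_simps)
      then show ?thesis using has_sum_cmult_right[OF \<rho>[OF a], of c] \<rho>[OF V(2)[OF a]] has_sum_unique by blast
    qed
    show "\<rho> (adj a \<circ> a) \<in> \<real>\<^sub>\<ge>\<^sub>0"
      using p(1) st a
      by (intro has_sum_nonneg_Reals[OF \<rho>[OF V(4)[OF V(5)[OF a] a]]] nonneg_Reals_mult_I)
         (auto simp: state_def)
  next
    have "((\<lambda>i. complex_of_real (p i) * \<sigma> i id) has_sum 1) I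
      \<longleftrightarrow> ((\<lambda>i. complex_of_real (p i)) has_sum complex_of_real 1) I"
      using st by (simp, intro has_sum_cong) (simp add: state_def)
    then show "\<rho> id = 1" using has_sum_of_real[OF p(2)] \<rho>[OF V(3)] has_sum_unique by blast
  qed
  moreover have "\<exists>(J :: nat set) q \<tau>. (\<forall>j\<in>J. 0 \<le> q j \<and> product_state GA GB (\<tau> j)) \<and> (q has_sum (1 :: real)) J \<and>
      (\<forall>a\<in>?V. ((\<lambda>j. complex_of_real (q j) * \<tau> j a) has_sum \<rho> a) J)"
  proof (intro exI conjI ballI)
    let ?n = "to_nat_on I" let ?g = "inv_into I ?n"
    have inj: "inj_on ?n I" using I by (rule inj_on_to_nat_on)
    have g: "?g (?n i) = i" if "i \<in> I" for i using inj that by simp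
    \<comment> \<open>\<open>?g\<close> inverts \<open>?n\<close> only on its image, which is
      exactly the range of summation.\<close>
    have sum: "((\<lambda>j. h (?g j)) has_sum s) (?n ` I) \<longleftrightarrow> (h has_sum s) I"
      for h :: "'i \<Rightarrow> 'b :: {comm_monoid_add, topological_space}" and s
      unfolding has_sum_reindex[OF inj] by (intro has_sum_cong) (simp add: g)
    show "((\<lambda>j. p (?g j)) has_sum 1) (?n ` I)" unfolding sum by (rule p)
    show "((\<lambda>j. complex_of_real (p (?g j)) * \<sigma> (?g j) a) has_sum \<rho> a) (?n ` I)" if "a \<in> ?V" for a
      unfolding sum[of "\<lambda>i. complex_of_real (p i) * \<sigma> i a"] using that by (rule \<rho>)
    fix j assume "j \<in> ?n ` I"
    then show "0 \<le> p (?g j)" "product_state GA GB (\<sigma> (?g j))" using p(1) \<sigma> g by auto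
  qed
  ultimately show ?thesis by (simp add: separable_state_def)
qed

subsection \<open>Fibres over the outcomes of a totally disconnected factor\<close>

context
  fixes GA :: "('gA, 'xA) groupoid" and GB :: "('gB, 'xB) groupoid"
    and \<pi> :: "('gA \<times> 'gB) op \<Rightarrow> ('xA \<times> 'xB) op"
  assumes GA: "is_groupoid GA" and td: "totally_disconnected GA"
    and GB: "is_groupoid GB"
    and \<pi>: "fundamental_representation (GA \<times>\<^sub>G GB) \<pi>"
begin

text \<open>Total disconnectedness makes every transition a loop: a loop at x is returned by the
  unit on either side, a loop elsewhere is annihilated on both.\<close>

lemma unit_transition_central: "transition_op GA (gunit GA x) \<in> commutant (range (transition_op GA))"
proof -
  have "transition_op GA (gunit GA x) \<circ> transition_op GA \<alpha> =
      transition_op GA \<alpha> \<circ> transition_op GA (gunit GA x)" for \<alpha>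
    using groupoid_simps(1-4)[OF GA] td
    by (auto simp: transition_op_comp[OF GA] totally_disconnected_def)
  then show ?thesis by (auto simp: commutant_def bounded_transition_op[OF GA])
qed

lemma unit_tensor_id_in_commutant:
  "transition_op GA (gunit GA x) \<otimes>\<^sub>o id \<in> commutant (range (transition_op (GA \<times>\<^sub>G GB)))"
proof -
  have "(transition_op GA (gunit GA x) \<otimes>\<^sub>o id) \<circ> transition_op (GA \<times>\<^sub>G GB) (\<alpha>, \<beta>) =
      transition_op (GA \<times>\<^sub>G GB) (\<alpha>, \<beta>) \<circ> (transition_op GA (gunit GA x) \<otimes>\<^sub>o id)" for \<alpha> \<beta>
    using commutantD[OF unit_transition_central, of "transition_op GA \<alpha>" x]
    by (simp add: transition_op_prod[OF GA GB] tensor_op_comp bounded_transition_op GA GB)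
  then show ?thesis by (auto simp: commutant_def tensor_op bounded_transition_op GA)
qed

text \<open>
  Total disconnectedness of \<open>GA\<close> makes \<open>\<lambda>(1\<^sub>x) \<otimes> id\<close> an element of the commutant, so every
  \<open>\<pi> a\<close> is block diagonal over the outcomes of \<open>GA\<close>.
\<close>

lemma rep_preserves_fibre:
  assumes a: "a \<in> \<V> (GA \<times>\<^sub>G GB)"
  shows "\<exists>g. \<pi> a (ket x \<otimes>\<^sub>2 f) = ket x \<otimes>\<^sub>2 g"
proof
  let ?G = "GA \<times>\<^sub>G GB" and ?E = "\<lambda>z. transition_op (GA \<times>\<^sub>G GB) (gunit (GA \<times>\<^sub>G GB) z)"
  let ?P = "\<lambda>x. transition_op GA (gunit GA x) \<otimes>\<^sub>o (id :: 'gB op)"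
  note G = is_groupoid_prod[OF GA GB]
  have E: "?E (x, y) = transition_op GA (gunit GA x) \<otimes>\<^sub>o transition_op GB (gunit GB y)" for x y
    by (simp add: transition_op_prod[OF GA GB, symmetric] prod_groupoid_def)
  note b = bounded_transition_op[OF GA] bounded_transition_op[OF GB] bounded_transition_op[OF G]
  have "ell2_fun (\<pi> a (ket (x, y))) (x', y') = 0" if ne: "x' \<noteq> x" for x' y y'
  proof (rule rep_matrix_entry_eq_0[OF G \<pi> a])
    fix \<Psi>
    \<comment> \<open>\<open>?P x\<close> is inserted next to the unit at (x, y), carried through
      \<open>a\<close>, and killed by the unit at (x', y') because x' differs from x.\<close>
    have EP: "?P x \<circ> ?E (x, y) = ?E (x, y)"
      using groupoid_simps(1,2)[OF GA, of x] groupoid_simps(3)[OF GA, of "gunit GA x"]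
      by (simp add: E tensor_op_comp b transition_op_comp[OF GA])
    have PE: "?E (x', y') \<circ> ?P x = (\<lambda>_. 0)"
    proof (rule bounded_op_tensor_eqI)
      fix \<gamma> :: 'gA and \<delta> :: 'gB
      have "(?E (x', y') \<circ> ?P x) (ket \<gamma> \<otimes>\<^sub>2 ket \<delta>) =
          (transition_op GA (gunit GA x') \<circ> transition_op GA (gunit GA x)) (ket \<gamma>) \<otimes>\<^sub>2
          transition_op GB (gunit GB y') (ket \<delta>)"
        by (simp add: E tensor_op b)
      also have "\<dots> = 0" using ne by (simp only: transition_op_comp[OF GA] groupoid_simps[OF GA]) simp
      finally show "(?E (x', y') \<circ> ?P x) (ket \<gamma> \<otimes>\<^sub>2 ket \<delta>) = 0" .
    qed (auto intro!: bounded_op_comp b tensor_op bounded_opI[of "\<lambda>_. 0" 0])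
    have "?E (x', y') (a (?E (x, y) \<Psi>)) = ?E (x', y') (a (?P x (?E (x, y) \<Psi>)))"
      using EP by (metis comp_apply)
    also have "\<dots> = ?E (x', y') (?P x (a (?E (x, y) \<Psi>)))"
      using commutantD[OF a[unfolded vN_algebra_eq[OF G]] unit_tensor_id_in_commutant[of x]]
      by (metis comp_apply)
    also have "\<dots> = 0" using PE by (metis comp_apply)
    finally show "?E (x', y') (a (?E (x, y) \<Psi>)) = 0" .
  qed
  then have ket: "\<pi> (?E (x', y')) (\<pi> a (ket x \<otimes>\<^sub>2 ket y)) = 0" if "x' \<noteq> x" for x' y y'
    using that by (simp add: rep_transition_op[OF G \<pi>] groupoid_simps[OF G] ket_Pair[symmetric])
  \<comment> \<open>Passage from basis vectors to arbitrary f: a bounded operator that vanishes on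
    all kets is zero.\<close>
  have 0: "ell2_fun (\<pi> a (ket x \<otimes>\<^sub>2 f)) (x', y') = 0" if "x' \<noteq> x" for x' y'
  proof -
    have "\<pi> (?E (x', y')) \<circ> (\<pi> a \<circ> (\<lambda>f. ket x \<otimes>\<^sub>2 f)) = (\<lambda>_. 0)"
    proof (rule bounded_op_eqI)
      show "bounded_op (\<pi> (?E (x', y')) \<circ> (\<pi> a \<circ> (\<lambda>f. ket x \<otimes>\<^sub>2 f)))"
        by (intro bounded_op_comp bounded_op_tensor_left rep_bounded[OF G \<pi>] a vN_transition_op[OF G])
    qed (use that ket in \<open>auto intro!: bounded_opI[of "\<lambda>_. 0" 0]\<close>)
    then have "\<pi> (?E (x', y')) (\<pi> a (ket x \<otimes>\<^sub>2 f)) = 0" by (simp add: fun_eq_iff)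
    then have "ell2_fun (ell2_fun (\<pi> a (ket x \<otimes>\<^sub>2 f)) (x', y') *\<^sub>C ket (x', y')) (x', y') = 0"
      by (simp add: rep_transition_op[OF G \<pi>] groupoid_simps[OF G] zero_ell2.rep_eq)
    then show ?thesis by (simp add: scaleC.rep_eq ket.rep_eq)
  qed
  show "\<pi> a (ket x \<otimes>\<^sub>2 f) = ket x \<otimes>\<^sub>2 slice_ell2 (\<pi> a (ket x \<otimes>\<^sub>2 f)) x"
  proof (rule ell2_eqI)
    fix z :: "'xA \<times> 'xB"
    obtain x' y' where z: "z = (x', y')" by (cases z)
    show "ell2_fun (\<pi> a (ket x \<otimes>\<^sub>2 f)) z = ell2_fun (ket x \<otimes>\<^sub>2 slice_ell2 (\<pi> a (ket x \<otimes>\<^sub>2 f)) x) z"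
      using 0[of x' y'] by (auto simp: z tensor_ell2.rep_eq ket.rep_eq slice_ell2.rep_eq)
  qed
qed

text \<open>
  On the fibre over \<open>x\<close> the operator \<open>\<pi> (a \<otimes> id)\<close> commutes with \<open>\<pi> (1\<^sub>x \<otimes> \<beta>)\<close>, that is, with all
  matrix units when \<open>GB\<close> is connected.
\<close>

lemma rep_tensor_id_scalar_on_fibre:
  assumes conn: "connected_groupoid GB" and a: "a \<in> \<V> GA"
  shows "\<exists>c. \<forall>f. \<pi> (a \<otimes>\<^sub>o id) (ket x \<otimes>\<^sub>2 f) = c *\<^sub>C (ket x \<otimes>\<^sub>2 f)"
proof -
  note G = is_groupoid_prod[OF GA GB]
  note b = vN_bounded[OF GA a] bounded_transition_op[OF GA] bounded_transition_op[OF GB]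
  define A where "A = \<pi> (a \<otimes>\<^sub>o (id :: 'gB op))"
  have V: "a \<otimes>\<^sub>o (id :: 'gB op) \<in> \<V> (GA \<times>\<^sub>G GB)" by (rule vN_tensor_id_right[OF GA GB a])
  have bA: "bounded_op A" unfolding A_def by (rule rep_bounded[OF G \<pi> V])
  \<comment> \<open>An arbitrary reference outcome. The scalar is the diagonal entry of
    \<open>A\<close> there, carried to every other outcome along a transition of
    \<open>GB\<close>.\<close>
  obtain y0 :: 'xB where True by blast
  define c where "c = ell2_fun (A (ket (x, y0))) (x, y0)"
  have "A (ket (x, y)) = c *\<^sub>C ket (x, y)" for y
  proof -
    obtain \<beta> where \<beta>: "src GB \<beta> = y0" "tgt GB \<beta> = y" using conn by (auto simp: connected_groupoid_def)
    let ?E = "transition_op (GA \<times>\<^sub>G GB) (gunit GA x, \<beta>)"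
    have E: "\<pi> ?E f = ell2_fun f (x, y0) *\<^sub>C ket (x, y)" for f
      by (simp add: rep_transition_op[OF G \<pi>]) (simp add: prod_groupoid_def groupoid_simps[OF GA] \<beta>)
    \<comment> \<open>\<open>a\<close> lies in the double commutant of the transitions and the unit
      at x in their commutant, so the first factors commute.\<close>
    have "(a \<otimes>\<^sub>o id) \<circ> ?E = ?E \<circ> (a \<otimes>\<^sub>o id)"
      using commutantD[OF a[unfolded vN_algebra_eq[OF GA]] unit_transition_central[of x]]
      by (simp add: transition_op_prod[OF GA GB] tensor_op_comp b)
    then have comm: "A \<circ> \<pi> ?E = \<pi> ?E \<circ> A"
      unfolding A_def by (simp add: rep_comp[OF G \<pi>, symmetric] V vN_transition_op[OF G])
    have "A (ket (x, y)) = (A \<circ> \<pi> ?E) (ket (x, y0))" by (simp add: E ket.rep_eq)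
    also have "\<dots> = \<pi> ?E (A (ket (x, y0)))" by (simp add: comm)
    \<comment> \<open>The matrix unit \<open>\<pi> ?E\<close> keeps only the coordinate at (x, y0),
      so of the image of \<open>ket (x, y0)\<close> just the entry c survives.\<close>
    also have "\<dots> = c *\<^sub>C ket (x, y)" by (simp add: E c_def)
    finally show ?thesis .
  qed
  then have "A \<circ> (\<lambda>f. ket x \<otimes>\<^sub>2 f) = (\<lambda>f. c *\<^sub>C (ket x \<otimes>\<^sub>2 f))"
    by (intro bounded_op_eqI bounded_op_comp bounded_op_scaleC bounded_op_tensor_left bA)
       (simp add: ket_Pair)
  then show ?thesis by (auto simp: A_def fun_eq_iff)
qed

text \<open>The two factors are the marginals of the vector state itself; the scalar by which
  \<open>\<pi> (a \<otimes>\<^sub>o id)\<close> acts on the fibre is the value of the first one, as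
  the vector has unit length.\<close>

lemma product_state_fibre_vector:
  assumes conn: "connected_groupoid GB" and f: "norm f = 1"
  shows "product_state GA GB (vector_functional \<pi> (ket x \<otimes>\<^sub>2 f))"
proof -
  note G = is_groupoid_prod[OF GA GB]
  let ?v = "ket x \<otimes>\<^sub>2 f" and ?\<sigma> = "vector_functional \<pi> (ket x \<otimes>\<^sub>2 f)"
  have v: "norm ?v = 1" using f by (simp add: norm_tensor)
  have st: "state (\<V> (GA \<times>\<^sub>G GB)) ?\<sigma>" by (rule state_vector_functional[OF G \<pi> v])
  have "?\<sigma> (a \<otimes>\<^sub>o b) = ?\<sigma> (a \<otimes>\<^sub>o id) * ?\<sigma> (id \<otimes>\<^sub>o b)" if a: "a \<in> \<V> GA" and b: "b \<in> \<V> GB" for a b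
  proof -
    obtain c where c: "\<And>g. \<pi> (a \<otimes>\<^sub>o id) (ket x \<otimes>\<^sub>2 g) = c *\<^sub>C (ket x \<otimes>\<^sub>2 g)"
      using rep_tensor_id_scalar_on_fibre[OF conn a] by blast
    have Va: "a \<otimes>\<^sub>o (id :: 'gB op) \<in> \<V> (GA \<times>\<^sub>G GB)" by (rule vN_tensor_id_right[OF GA GB a])
    have Vb: "(id :: 'gA op) \<otimes>\<^sub>o b \<in> \<V> (GA \<times>\<^sub>G GB)" by (rule vN_tensor_id_left[OF GA GB b])
    \<comment> \<open>\<open>b\<close> acts first and stays in the fibre, so
      \<open>\<pi> (a \<otimes>\<^sub>o id)\<close> still meets a vector on which it is the scalar
      c.\<close>
    obtain g where g: "\<pi> (id \<otimes>\<^sub>o b) ?v = ket x \<otimes>\<^sub>2 g" using rep_preserves_fibre[OF Vb] by blast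
    have "a \<otimes>\<^sub>o b = (a \<otimes>\<^sub>o id) \<circ> (id \<otimes>\<^sub>o b)"
      by (simp add: tensor_op_comp vN_bounded[OF GA a] vN_bounded[OF GB b])
    then have "\<pi> (a \<otimes>\<^sub>o b) ?v = c *\<^sub>C \<pi> (id \<otimes>\<^sub>o b) ?v"
      by (simp add: rep_comp[OF G \<pi> Va Vb] c g)
    then show ?thesis
      using v by (simp add: vector_functional_def cinner_scaleC_right c cinner_self)
  qed
  then show ?thesis
    unfolding product_state_def
    using st state_tensor_id_right[OF GA GB st] state_tensor_id_left[OF GA GB st] by blast
qed

end

section \<open>The evolved mixture\<close>

theorem theorem2:
  fixes GA :: "('gA, 'xA) groupoid" and GB :: "('gB, 'xB) groupoid"
    and \<pi>\<^sub>0 :: "('gA \<times> 'gB) op \<Rightarrow> ('xA \<times> 'xB) op"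
    and u :: "real \<Rightarrow> ('gA \<times> 'gB) op"
    and H :: "(('gA \<times> 'gB) ell2 \<times> ('gA \<times> 'gB) ell2) set"
    and \<Phi> :: "real \<Rightarrow> ('gA \<times> 'gB) op \<Rightarrow> ('gA \<times> 'gB) op"
    and p :: "'xA \<Rightarrow> real" and \<psi>B :: "'xA \<Rightarrow> 'xB ell2"
    and \<rho> :: "('gA \<times> 'gB) op \<Rightarrow> complex"
  assumes "is_groupoid GA" and "countable (UNIV :: 'gA set)" and "totally_disconnected GA"
    and "is_groupoid GB" and "countable (UNIV :: 'gB set)" and "connected_groupoid GB"
    and "fundamental_representation (GA \<times>\<^sub>G GB) \<pi>\<^sub>0"
    and "unitary_group (\<V> (GA \<times>\<^sub>G GB)) u" and "H = stone_generator u"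
    and "\<And>t a. a \<in> \<V> (GA \<times>\<^sub>G GB) \<Longrightarrow> \<Phi> t a = u t \<circ> a \<circ> adj (u t)"
    and "\<And>x. p x \<ge> 0" and "(p has_sum 1) UNIV"
    and "\<And>x. norm (\<psi>B x) = 1"
    and "\<And>a. a \<in> \<V> (GA \<times>\<^sub>G GB) \<Longrightarrow>
      ((\<lambda>x. complex_of_real (p x) * vector_functional \<pi>\<^sub>0 (ket x \<otimes>\<^sub>2 \<psi>B x) a) has_sum \<rho> a) UNIV"
  shows "separable_state GA GB (\<lambda>a. \<rho> (\<Phi> t a))"
proof -
  note GA = assms(1) and GB = assms(4) and \<pi> = assms(7)
  note G = is_groupoid_prod[OF GA GB]
  note u = unitary_group_vN_algebra[OF G assms(8), of t]
  \<comment> \<open>Schroedinger picture: moving the unitary to the left of the inner product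
    replaces each vector by \<open>w x\<close>, while the weights \<open>p\<close> stay
    fixed.\<close>
  define w where "w x = \<pi>\<^sub>0 (adj (u t)) (ket x \<otimes>\<^sub>2 \<psi>B x)" for x
  have evolve: "vector_functional \<pi>\<^sub>0 (ket x \<otimes>\<^sub>2 \<psi>B x) (u t \<circ> a \<circ> adj (u t)) = vector_functional \<pi>\<^sub>0 (w x) a"
    if a: "a \<in> \<V> (GA \<times>\<^sub>G GB)" for x a
  proof -
    have "\<pi>\<^sub>0 (u t) = adj (\<pi>\<^sub>0 (adj (u t)))"
      using u by (simp add: rep_adj[OF G \<pi>, symmetric] adj_adj vN_bounded[OF G])
    then show ?thesis
      using a u by (simp add: vector_functional_def w_def rep_comp[OF G \<pi>] vN_comp[OF G]
          cinner_adj_right rep_bounded[OF G \<pi>])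
  qed
  have "product_state GA GB (vector_functional \<pi>\<^sub>0 (w x))" for x
  proof -
    obtain f where f: "w x = ket x \<otimes>\<^sub>2 f"
      using rep_preserves_fibre[OF GA assms(3) GB \<pi> u(2)] unfolding w_def by blast
    \<comment> \<open>The norm is found by evaluating \<open>evolve\<close> at the identity, where
      \<open>u t \<circ> id \<circ> adj (u t)\<close> is \<open>id\<close>.\<close>
    have "complex_of_real ((norm (w x))\<^sup>2) = complex_of_real 1"
      using evolve[OF vN_id[OF G], of x] u(3) assms(13)[of x]
      by (simp add: vector_functional_def rep_id[OF G \<pi>] cinner_self norm_tensor)
    then have "norm f = 1"
      unfolding of_real_eq_iff f norm_tensor using norm_ge_zero[of f]
      by (auto simp: power2_eq_1_iff simp del: norm_ge_zero)
    then show ?thesis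
      unfolding f by (rule product_state_fibre_vector[OF GA assms(3) GB \<pi> assms(6)])
  qed
  moreover have "countable (UNIV :: 'xA set)"
  proof -
    \<comment> \<open>Every outcome is the source of its unit, so countability passes from
      transitions to outcomes.\<close>
    have "src GA ` UNIV = UNIV" using groupoid_simps(1)[OF GA] by (metis surjI)
    then show ?thesis using assms(2) by (metis countable_image)
  qed
  moreover have "((\<lambda>x. complex_of_real (p x) * vector_functional \<pi>\<^sub>0 (w x) a) has_sum \<rho> (\<Phi> t a)) UNIV"
    if a: "a \<in> \<V> (GA \<times>\<^sub>G GB)" for a
    \<comment> \<open>The given expansion of \<rho> is read at
      \<open>u t \<circ> a \<circ> adj (u t)\<close>, which lies in the algebra again.\<close>
    using assms(14)[OF vN_comp[OF G vN_comp[OF G u(1) a] u(2)]] by (simp add: evolve[OF a] assms(10)[OF a])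
  ultimately show ?thesis
    using assms(11,12) by (intro separable_stateI[OF GA GB]) auto
qed

end
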